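(* Let $[Q]$ be a toric poset. Then $\Psi_{\rm tor}^{[Q]}(\mathbf{x})$ can always be expressed over the denominator $$\prod_{\{i,j\}\in[Q]_{\rm Hasse}}(x_i-x_j),$$ where the product is taken over all edges $\{i,j\}$ of (the underlying graph of) the toric Hasse diagram $[Q]_{\rm Hasse}$; that is, $\Psi_{\rm tor}^{[Q]}(\mathbf{x})$ can be written as a polynomial divided by this product (each factor $x_i-x_j$ being taken up to sign).
   Context: All quivers are finite directed graphs that are simple (no loops, no parallel or anti-parallel arcs) and acyclic (no directed cycles), on a vertex set $V=[n]=\{1,\dots,n\}$. A source is a vertex all of whose incident arcs point away from it; a sink is a vertex all of whose incident arcs point into it (an isolated vertex is both). A flip at a source or sink $k$ reverses all arcs incident to $k$. Two acyclic quivers are equivalent if they are related by a finite sequence of flips; the equivalence class $[Q]$ of $Q$ is called a toric poset. All members of $[Q]$ have the same underlying undirected graph, called the underlying graph of $[Q]$. A toric directed path in a quiver $Q'$ is a sequence of distinct vertices $y_1,\dots,y_m$ such that $Q'$ contains the arcs $y_1\to y_2\to\cdots\to y_m$ and also the arc $y_1\to y_m$ (a single vertex and a single arc also count); its length is $m-1$. A toric directed path is maximal if it is maximal with respect to containment. For $Q'\in[Q]$, let $Q'_{\rm Hasse}$ be obtained from $Q'$ by removing each arc $i\to j$ for which $Q'$ contains a toric directed path from $i$ to $j$ that is both non-maximal and has length strictly greater than one. The toric Hasse diagram is $[Q]_{\rm Hasse}:=[Q'_{\rm Hasse}]$; it is known not to depend on the choice of $Q'\in[Q]$. For example, if $Q'$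 has arcs $1\to2$, $2\to3$, $2\to4$, $4\to5$, $1\to5$, $2\to5$, then $Q'_{\rm Hasse}$ has arcs $1\to2$, $2\to3$, $2\to4$, $4\to5$, $1\to5$. A toric total order $[w]=[(w_1,\dots,w_n)]$ is the equivalence class of a permutation $(w_1,\dots,w_n)$ of $V$ under cyclic rotation $(w_1,\dots,w_n)\mapsto(w_2,\dots,w_n,w_1)$. For a graph $G$ on $V$, let $\mathcal{A}_{\rm tor}(G)$ be the image in $\mathbb{R}^n/\mathbb{Z}^n$ of $\bigcup_{\{i,j\}\in G}\{x_i=x_j\}\subset\mathbb{R}^n$. A point of $\mathbb{R}^n/\mathbb{Z}^n-\mathcal{A}_{\rm tor}(G)$ determines an acyclic orientation of $G$: $i\to j$ if $x_i \bmod 1< x_j \bmod 1$ (values in $[0,1)$), and $j\to i$ otherwise. For a toric poset $[Q]$ with underlying graph $G$, its toric chamber $c_{[Q]}$ is the set of points whose orientation lies in $[Q]$ (these sets are exactly the connected components of $\mathbb{R}^n/\mathbb{Z}^n-\mathcal{A}_{\rm tor}(G)$). For a toric total order $[w]$, $c_{[w]}$ is the set of points with pairwise distinct coordinates such that listing the indices in increasing order of $x_i\bmod 1$ gives a member of $[w]$. $[w]$ is a toric total extension of $[Q]$ if $c_{[w]}\subseteq c_{[Q]}$; the set of these is $\mathcal{L}_{\rm tor}([Q])$. Define $\Psi_{\rm tor}^{[Q]}(\mathbf{x})=\sum_{[w]\in\mathcal{L}_{\rm tor}([Q])}\Psi_{\rm tor}^{[w]}(\mathbf{x})$, where $\Psi_{\rm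 tor}^{[w]}(\mathbf{x})=\dfrac{1}{(x_{w_1}-x_{w_2})(x_{w_2}-x_{w_3})\cdots(x_{w_{n-1}}-x_{w_n})(x_{w_n}-x_{w_1})}$ and $\mathbf{x}=(x_1,\dots,x_n)$ are indeterminates.
   Formalization: The case of exactly two vertices (n = 2) is excluded, since there Ψ_tor = −1/(x_1−x_2)² has a double pole while the Hasse product is 1 or x_1−x_2, so the claim fails. *)

theory Defs
  imports
    Complex_Main
    "HOL-Library.FuncSet"
    "HOL-Library.Sublist"
    "HOL-Library.Poly_Mapping"
    "HOL-Combinatorics.Multiset_Permutations"
    "HOL-Computational_Algebra.Fraction_Field"
begin

section \<open>Toric posets\<close>

text \<open>A quiver on the vertex set \<open>{1..n}\<close> is its set of arcs; acyclicity already excludes loops and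
  anti-parallel arcs.\<close>

definition acyclic_quiver :: "nat \<Rightarrow> (nat \<times> nat) set \<Rightarrow> bool" where
  "acyclic_quiver n Q \<longleftrightarrow> Q \<subseteq> {1..n} \<times> {1..n} \<and> acyclic Q"

definition is_source :: "(nat \<times> nat) set \<Rightarrow> nat \<Rightarrow> bool" where
  "is_source Q k \<longleftrightarrow> (\<forall>i. (i, k) \<notin> Q)"

definition is_sink :: "(nat \<times> nat) set \<Rightarrow> nat \<Rightarrow> bool" where
  "is_sink Q k \<longleftrightarrow> (\<forall>j. (k, j) \<notin> Q)"

definition flip :: "nat \<Rightarrow> (nat \<times> nat) set \<Rightarrow> (nat \<times> nat) set" where
  "flip k Q = {(i, j). (if i = k \<or> j = k then (j, i) \<in> Q else (i, j) \<in> Q)}"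

definition flip_step :: "nat \<Rightarrow> (nat \<times> nat) set \<Rightarrow> (nat \<times> nat) set \<Rightarrow> bool" where
  "flip_step n Q Q' \<longleftrightarrow> (\<exists>k\<in>{1..n}. (is_source Q k \<or> is_sink Q k) \<and> Q' = flip k Q)"

text \<open>Flips are involutive, so reachability by flips is already symmetric.\<close>

definition toric_class :: "nat \<Rightarrow> (nat \<times> nat) set \<Rightarrow> (nat \<times> nat) set set" where
  "toric_class n Q = {Q'. (flip_step n)\<^sup>*\<^sup>* Q Q'}"

definition toric_poset :: "nat \<Rightarrow> (nat \<times> nat) set set \<Rightarrow> bool" where
  "toric_poset n P \<longleftrightarrow> (\<exists>Q. acyclic_quiver n Q \<and> P = toric_class n Q)"

text \<open>Flips do not change the underlying graph of a quiver, so all members of a class contribute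
  the same edges.\<close>

definition underlying_graph :: "(nat \<times> nat) set set \<Rightarrow> nat set set" where
  "underlying_graph P = {{i, j} | i j. \<exists>Q\<in>P. (i, j) \<in> Q}"


section \<open>Toric Hasse diagrams\<close>

definition toric_path :: "nat \<Rightarrow> (nat \<times> nat) set \<Rightarrow> nat list \<Rightarrow> bool" where
  "toric_path n Q ys \<longleftrightarrow>
     ys \<noteq> [] \<and> distinct ys \<and> set ys \<subseteq> {1..n} \<and>
     successively (\<lambda>i j. (i, j) \<in> Q) ys \<and>
     (length ys \<ge> 2 \<longrightarrow> (hd ys, last ys) \<in> Q)"

text \<open>Containment of toric directed paths is containment as directed paths
  \<open>y\<^sub>1 \<rightarrow> \<dots> \<rightarrow> y\<^sub>m\<close>, i.e. as contiguous subpaths, and not containment of vertex sets.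
  For instance, in the quiver with arcs \<open>12, 23, 24, 45, 15, 25\<close> the path \<open>1 \<rightarrow> 2 \<rightarrow> 5\<close> is maximal
  although its vertices lie on \<open>1 \<rightarrow> 2 \<rightarrow> 4 \<rightarrow> 5\<close>; the arc \<open>15\<close> belongs to the Hasse diagram.\<close>

definition maximal_toric_path :: "nat \<Rightarrow> (nat \<times> nat) set \<Rightarrow> nat list \<Rightarrow> bool" where
  "maximal_toric_path n Q ys \<longleftrightarrow>
     toric_path n Q ys \<and> (\<nexists>zs. toric_path n Q zs \<and> strict_sublist ys zs)"

definition hasse_quiver :: "nat \<Rightarrow> (nat \<times> nat) set \<Rightarrow> (nat \<times> nat) set" where
  "hasse_quiver n Q = Q - {(i, j). \<exists>ys. toric_path n Q ys \<and> hd ys = i \<and> last ys = j \<and>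
     \<not> maximal_toric_path n Q ys \<and> length ys - 1 > 1}"

definition toric_hasse :: "nat \<Rightarrow> (nat \<times> nat) set \<Rightarrow> (nat \<times> nat) set set" where
  "toric_hasse n Q = toric_class n (hasse_quiver n Q)"


section \<open>The torus, toric arrangements and toric chambers\<close>

text \<open>The torus is the quotient of the space of real vectors indexed by \<open>{1..n}\<close> by the integer
  vectors; its points are cosets.\<close>

definition real_space :: "nat \<Rightarrow> (nat \<Rightarrow> real) set" where
  "real_space n = {1..n} \<rightarrow>\<^sub>E UNIV"

definition torus_rel :: "nat \<Rightarrow> ((nat \<Rightarrow> real) \<times> (nat \<Rightarrow> real)) set" where
  "torus_rel n = {(x, y) \<in> real_space n \<times> real_space n. \<forall>i\<in>{1..n}. x i - y i \<in> \<int>}"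

definition torus :: "nat \<Rightarrow> (nat \<Rightarrow> real) set set" where
  "torus n = real_space n // torus_rel n"

definition torus_proj :: "nat \<Rightarrow> (nat \<Rightarrow> real) \<Rightarrow> (nat \<Rightarrow> real) set" where
  "torus_proj n x = torus_rel n `` {x}"

text \<open>\<open>coord p i\<close> is the \<open>i\<close>-th coordinate modulo 1 of the torus point \<open>p\<close>, as a number in \<open>[0,1)\<close>;
  it does not depend on the chosen element of the coset \<open>p\<close>.\<close>

definition coord :: "(nat \<Rightarrow> real) set \<Rightarrow> nat \<Rightarrow> real" where
  "coord p i = frac ((SOME x. x \<in> p) i)"

definition toric_arrangement :: "nat \<Rightarrow> nat set set \<Rightarrow> (nat \<Rightarrow> real) set set" where
  "toric_arrangement n G =
     torus_proj n ` {x \<in> real_space n. \<exists>i j. {i, j} \<in> G \<and> x i = x j}"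

definition torus_orientation :: "nat set set \<Rightarrow> (nat \<Rightarrow> real) set \<Rightarrow> (nat \<times> nat) set" where
  "torus_orientation G p = {(i, j). {i, j} \<in> G \<and> coord p i < coord p j}"

definition toric_chamber :: "nat \<Rightarrow> (nat \<times> nat) set set \<Rightarrow> (nat \<Rightarrow> real) set set" where
  "toric_chamber n P =
     {p \<in> torus n - toric_arrangement n (underlying_graph P).
        torus_orientation (underlying_graph P) p \<in> P}"


section \<open>Toric total orders and toric total extensions\<close>

definition rotation_class :: "nat list \<Rightarrow> nat list set" where
  "rotation_class w = {rotate k w | k. True}"

definition toric_total_orders :: "nat \<Rightarrow> nat list set set" where
  "toric_total_orders n = rotation_class ` permutations_of_set {1..n}"

definition order_chamber :: "nat \<Rightarrow> nat list set \<Rightarrow> (nat \<Rightarrow> real) set set" where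
  "order_chamber n W =
     {p \<in> torus n. inj_on (coord p) {1..n} \<and>
        (\<exists>w\<in>W. sorted_wrt (\<lambda>i j. coord p i < coord p j) w)}"

definition toric_total_extensions :: "nat \<Rightarrow> (nat \<times> nat) set set \<Rightarrow> nat list set set" where
  "toric_total_extensions n P =
     {W \<in> toric_total_orders n. order_chamber n W \<subseteq> toric_chamber n P}"


section \<open>Rational functions\<close>

text \<open>Polynomials in indeterminates \<open>x\<^sub>i\<close> indexed by natural numbers, as finitely supported maps
  from exponent vectors to coefficients; only \<open>x\<^sub>1, \<dots>, x\<^sub>n\<close> will occur.\<close>

type_synonym 'k mpoly = "(nat \<Rightarrow>\<^sub>0 nat) \<Rightarrow>\<^sub>0 'k"

definition poly_vars :: "'k::field mpoly \<Rightarrow> nat set" where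
  "poly_vars p = (\<Union>m\<in>Poly_Mapping.keys p. Poly_Mapping.keys m)"

definition poly_fract :: "'k::field mpoly \<Rightarrow> 'k mpoly fract" where
  "poly_fract p = Fract p 1"

definition indet :: "nat \<Rightarrow> 'k::field mpoly fract" where
  "indet i = poly_fract (Poly_Mapping.single (Poly_Mapping.single i 1) 1)"

definition Psi_word :: "nat list \<Rightarrow> 'k::field mpoly fract" where
  "Psi_word w =
     1 / (\<Prod>k<length w. indet (w ! k) - indet (w ! (Suc k mod length w)))"

text \<open>\<open>Psi_word\<close> is invariant under rotation, so the choice of representative is immaterial.\<close>

definition Psi_order :: "nat list set \<Rightarrow> 'k::field mpoly fract" where
  "Psi_order W = Psi_word (SOME w. w \<in> W)"

text \<open>For \<open>n = 1\<close> the denominator of \<open>Psi_word\<close> vanishes and the quotient is 0 by convention.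
  For \<open>n = 2\<close> the only summand is \<open>- 1 / (x\<^sub>1 - x\<^sub>2)\<^sup>2\<close>, which has a double pole and hence cannot be
  expressed over a denominator with simple factors; that case has to be excluded.\<close>

definition Psi_tor :: "nat \<Rightarrow> (nat \<times> nat) set set \<Rightarrow> 'k::field mpoly fract" where
  "Psi_tor n P = (\<Sum>W\<in>toric_total_extensions n P. Psi_order W)"

text \<open>The sign of each factor is fixed by orienting every edge from its smaller to its larger
  vertex.\<close>

definition edge_product :: "nat set set \<Rightarrow> 'k::field mpoly fract" where
  "edge_product G = (\<Prod>(i, j)\<in>{(i, j). i < j \<and> {i, j} \<in> G}. indet i - indet j)"

end

theory Submission
  imports Defs
begin

text \<open>For \<open>n \<ge> 3\<close>, every \<open>Psi_word\<close> has only simple poles, along hyperplanes \<open>x\<^sub>i = x\<^sub>j\<close> for cyclically adjacent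
  letters \<open>i, j\<close>; so it suffices that \<open>Psi_tor\<close> has no pole along \<open>x\<^sub>i = x\<^sub>j\<close> when \<open>{i, j}\<close> is not a
  Hasse edge. If \<open>{i, j}\<close> is not an edge at all, swapping adjacent \<open>i\<close> and \<open>j\<close> pairs up the toric
  total extensions in which they are adjacent, and the residues of each pair cancel. If \<open>{i, j}\<close> is
  an edge that is removed from the Hasse diagram, then \<open>i\<close> and \<open>j\<close> are adjacent in no toric total
  extension.\<close>

section \<open>Linear factors of multivariate polynomials\<close>

text \<open>The overview leaves open why the absence of poles yields a polynomial. No factorization
  theory is used: \<open>lin i j\<close> generates the kernel of the substitution replacing x_i by
  x_j, and this substitution maps into an integral domain, so \<open>lin i j\<close> is prime. A
  denominator that is a product of such forms can then be stripped one factor at a time, over an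
  arbitrary field. Numerators stay within the variables of \<open>{1..n}\<close>, because all other
  variables may be set to 0. A second gap separates geometry from words, as extensions are defined
  by inclusion of chambers. The bridge is that moving the first letter of a word to its end flips
  the induced orientation at a source. Hence a cyclic word extends \<open>P\<close> exactly when one
  of its linear readings, no matter which, induces an orientation belonging to \<open>P\<close>.
  Swapping letters and excluding adjacent letters thereby become questions about a single
  word.\<close>

definition Var :: "nat \<Rightarrow> 'k::field mpoly" where
  "Var k = Poly_Mapping.single (Poly_Mapping.single k 1) 1"

definition Const :: "'k::field \<Rightarrow> 'k mpoly" where
  "Const c = Poly_Mapping.single 0 c"

definition subst_monom :: "(nat \<Rightarrow> 'k::field mpoly) \<Rightarrow> (nat \<Rightarrow>\<^sub>0 nat) \<Rightarrow> 'k mpoly" where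
  "subst_monom s m = (\<Prod>k\<in>Poly_Mapping.keys m. s k ^ Poly_Mapping.lookup m k)"

text \<open>The evaluation homomorphism fixing constants. Two instances matter: identifying two
  variables, and setting variables to 0.\<close>

definition subst_poly :: "(nat \<Rightarrow> 'k::field mpoly) \<Rightarrow> 'k mpoly \<Rightarrow> 'k mpoly" where
  "subst_poly s p =
     (\<Sum>m\<in>Poly_Mapping.keys p. Const (Poly_Mapping.lookup p m) * subst_monom s m)"

lemma Const_0 [simp]: "Const 0 = 0"
  by (simp add: Const_def)

lemma Const_add: "Const (a + b) = Const a + Const b"
  by (simp add: Const_def single_add)

lemma Const_mult: "Const (a * b) = Const a * Const b"
  by (simp add: Const_def mult_single)

lemma subst_monom_0 [simp]: "subst_monom s 0 = 1"
  by (simp add: subst_monom_def)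

lemma subst_monom_superset:
  assumes "finite A" "Poly_Mapping.keys m \<subseteq> A"
  shows "subst_monom s m = (\<Prod>k\<in>A. s k ^ Poly_Mapping.lookup m k)"
  unfolding subst_monom_def
  by (rule prod.mono_neutral_left) (use assms in \<open>auto simp: in_keys_iff\<close>)

lemma subst_monom_add: "subst_monom s (m + m') = subst_monom s m * subst_monom s m'"
proof -
  let ?A = "Poly_Mapping.keys m \<union> Poly_Mapping.keys m'"
  have "Poly_Mapping.keys (m + m') \<subseteq> ?A"
    by (rule keys_add)
  then show ?thesis
    by (subst (1 2 3) subst_monom_superset[of ?A])
      (auto simp: lookup_add power_add prod.distrib)
qed

lemma subst_poly_0 [simp]: "subst_poly s 0 = 0"
  by (simp add: subst_poly_def)

lemma subst_poly_single:
  "subst_poly s (Poly_Mapping.single m c) = Const c * subst_monom s m"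
  by (simp add: subst_poly_def)

lemma subst_poly_add: "subst_poly s (p + q) = subst_poly s p + subst_poly s q"
  unfolding subst_poly_def
  by (rule setsum_keys_plus_distrib) (simp_all add: Const_add distrib_right)

text \<open>Updating a key outside the support amounts to adding a \<open>single\<close>, so the
  update induction becomes an additive one.\<close>

lemma poly_mapping_induct_single_add [case_names single add]:
  assumes "\<And>k c. P (Poly_Mapping.single k c)"
    and "\<And>p q. P p \<Longrightarrow> P q \<Longrightarrow> P (p + q)"
  shows "P (p :: 'a \<Rightarrow>\<^sub>0 'b::comm_monoid_add)"
proof (induction p rule: update_induct)
  case const
  \<comment> \<open>The zero map is a \<open>single\<close> with coefficient 0 at an arbitrary
    key.\<close>
  then show ?case using assms(1)[of undefined 0] by simp
next
  case (update f k c)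
  have "Poly_Mapping.update k c f = f + Poly_Mapping.single k c"
    using update(1)
    by (intro poly_mapping_eqI) (auto simp: lookup_update lookup_add lookup_single in_keys_iff)
  then show ?case using assms(2)[OF update(3) assms(1)] by simp
qed

lemma subst_poly_mult: "subst_poly s (p * q) = subst_poly s p * subst_poly s q"
proof (induction p rule: poly_mapping_induct_single_add)
  case (single m c)
  show ?case
  proof (induction q rule: poly_mapping_induct_single_add)
    case (single m' c')
    then show ?case
      by (simp add: mult_single subst_poly_single Const_mult subst_monom_add mult_ac)
  qed (simp add: distrib_left subst_poly_add)
qed (simp add: distrib_right subst_poly_add)

lemma subst_poly_Const [simp]: "subst_poly s (Const c) = Const c"
  by (simp add: Const_def subst_poly_single)

lemma Const_1 [simp]: "Const 1 = 1"
  by (simp add: Const_def)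

lemma subst_poly_1 [simp]: "subst_poly s 1 = 1"
  using subst_poly_Const[of s 1] by simp

lemma subst_poly_Var [simp]: "subst_poly s (Var k) = s k"
  by (simp add: Var_def subst_poly_single subst_monom_def)

lemma subst_poly_minus: "subst_poly s (- p) = - subst_poly s p"
  using subst_poly_add[of s p "- p"] by (simp add: eq_neg_iff_add_eq_0 add.commute)

lemma subst_poly_diff: "subst_poly s (p - q) = subst_poly s p - subst_poly s q"
  using subst_poly_add[of s p "- q"] by (simp add: subst_poly_minus)

text \<open>Constants and variables generate the polynomial ring. The additive induction is applied
  to terms and again to exponent vectors, which leaves powers of one variable.\<close>

lemma mpoly_induct [case_names Const Var add mult]:
  assumes C: "\<And>c. P (Const c)" and V: "\<And>k. P (Var k)"
    and A: "\<And>p q. P p \<Longrightarrow> P q \<Longrightarrow> P (p + q)"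
    and M: "\<And>p q. P p \<Longrightarrow> P q \<Longrightarrow> P (p * q)"
  shows "P (p :: 'k::field mpoly)"
proof (induction p rule: poly_mapping_induct_single_add)
  case (single m c)
  have "P (Poly_Mapping.single m 1)"
  proof (induction m rule: poly_mapping_induct_single_add)
    case (single k e)
    show ?case
    proof (induction e)
      case 0
      then show ?case using C[of 1] by (simp add: Const_def)
    next
      case (Suc e)
      have "Poly_Mapping.single (Poly_Mapping.single k (Suc e)) 1 =
          (Var k * Poly_Mapping.single (Poly_Mapping.single k e) 1 :: 'k mpoly)"
        by (simp add: Var_def mult_single flip: single_add)
      then show ?case using M[OF V Suc] by simp
    qed
  next
    case (add m m')
    then show ?case using M[OF add] by (simp add: mult_single)
  qed
  then have "P (Const c * Poly_Mapping.single m 1)"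
    by (intro M C)
  then show ?case by (simp add: Const_def mult_single)
qed (rule A)

section \<open>The linear forms of the hyperplanes and their primality\<close>

definition lin :: "nat \<Rightarrow> nat \<Rightarrow> 'k::field mpoly" where
  "lin i j = Var i - Var j"

text \<open>The quotient map modulo \<open>lin i j\<close>, realised inside the same ring.\<close>

abbreviation identify :: "nat \<Rightarrow> nat \<Rightarrow> 'k::field mpoly \<Rightarrow> 'k mpoly" where
  "identify i j \<equiv> subst_poly (\<lambda>k. Var (if k = i then j else k))"

lemma poly_vars_Var [simp]: "poly_vars (Var k) = {k}"
  by (simp add: poly_vars_def Var_def)

lemma Var_inject [simp]: "(Var i :: 'k::field mpoly) = Var j \<longleftrightarrow> i = j"
  by (metis poly_vars_Var singleton_inject)

text \<open>The product case is the telescoping p q - p' q' = (p - p') q + p' (q - q').\<close>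

lemma lin_dvd_diff_identify: "lin i j dvd p - identify i j p"
proof (induction p rule: mpoly_induct)
  case (Var k)
  then show ?case by (auto simp: lin_def)
next
  case (add p q)
  then have "lin i j dvd (p - identify i j p) + (q - identify i j q)"
    by (rule dvd_add)
  then show ?case by (simp add: subst_poly_add algebra_simps)
next
  case (mult p q)
  then have "lin i j dvd (p - identify i j p) * q + identify i j p * (q - identify i j q)"
    by (intro dvd_add dvd_mult2 dvd_mult)
  then show ?case by (simp add: subst_poly_mult algebra_simps)
qed simp

lemma lin_dvd_iff: "lin i j dvd p \<longleftrightarrow> identify i j p = 0"
proof
  assume "lin i j dvd p"
  then show "identify i j p = 0"
    by (auto simp: lin_def subst_poly_mult subst_poly_diff)
next
  assume "identify i j p = 0"
  then show "lin i j dvd p"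
    using lin_dvd_diff_identify[of i j p] by simp
qed

text \<open>Primality: the image of a product under \<open>identify i j\<close> vanishes only if the
  image of a factor does. For i = j the form is 0 and this says that there are no zero
  divisors.\<close>

lemma lin_dvd_mult_iff: "lin i j dvd p * q \<longleftrightarrow> lin i j dvd p \<or> lin i j dvd q"
  by (simp add: lin_dvd_iff subst_poly_mult)

lemma not_lin_dvd_1: "\<not> lin i j dvd 1"
  by (simp add: lin_dvd_iff)

text \<open>Identifying x_i with x_j merges no other pair of variables.\<close>

lemma not_lin_dvd_lin: "a \<noteq> b \<Longrightarrow> {a, b} \<noteq> {i, j} \<Longrightarrow> \<not> lin i j dvd lin a b"
  unfolding lin_dvd_iff unfolding lin_def subst_poly_diff by auto

section \<open>Variables occurring in a polynomial\<close>

lemma poly_vars_add: "poly_vars (p + q) \<subseteq> poly_vars p \<union> poly_vars q"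
  unfolding poly_vars_def using keys_add[of p q] by blast

lemma poly_vars_mult: "poly_vars (p * q) \<subseteq> poly_vars p \<union> poly_vars q"
proof
  fix x assume "x \<in> poly_vars (p * q)"
  then obtain a b where "a \<in> Poly_Mapping.keys p" "b \<in> Poly_Mapping.keys q"
      "x \<in> Poly_Mapping.keys (a + b)"
    unfolding poly_vars_def using keys_mult[of p q] by blast
  then show "x \<in> poly_vars p \<union> poly_vars q"
    unfolding poly_vars_def using keys_add[of a b] by blast
qed

lemma poly_vars_Const [simp]: "poly_vars (Const c) = {}"
  by (simp add: poly_vars_def Const_def)

lemma poly_vars_0 [simp]: "poly_vars 0 = {}" and poly_vars_1 [simp]: "poly_vars 1 = {}"
  by (simp_all add: poly_vars_def)

lemma poly_vars_minus [simp]: "poly_vars (- p) = poly_vars p"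
  by (simp add: poly_vars_def in_keys_iff)

lemma poly_vars_diff: "poly_vars (p - q) \<subseteq> poly_vars p \<union> poly_vars q"
  using poly_vars_add[of p "- q"] by simp

lemma poly_vars_lin: "poly_vars (lin i j) \<subseteq> {i, j}"
  using poly_vars_diff[of "Var i" "Var j"] by (auto simp: lin_def)

abbreviation restrict_vars :: "nat set \<Rightarrow> 'k::field mpoly \<Rightarrow> 'k mpoly" where
  "restrict_vars V \<equiv> subst_poly (\<lambda>k. if k \<in> V then Var k else 0)"

lemma poly_vars_restrict_vars: "poly_vars (restrict_vars V p) \<subseteq> V"
proof (induction p rule: mpoly_induct)
  case (add p q)
  then show ?case using poly_vars_add by (fastforce simp: subst_poly_add)
next
  case (mult p q)
  then show ?case using poly_vars_mult by (fastforce simp: subst_poly_mult)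
qed auto

lemma subst_poly_Var_id: "subst_poly Var p = p"
  by (induction p rule: mpoly_induct) (simp_all add: subst_poly_add subst_poly_mult)

lemma restrict_vars_id:
  assumes "poly_vars p \<subseteq> V"
  shows "restrict_vars V p = p"
proof -
  have "restrict_vars V p = subst_poly Var p"
    unfolding subst_poly_def subst_monom_def
  proof (intro sum.cong arg_cong2[of _ _ _ _ "(*)"] prod.cong refl)
    fix m k assume "m \<in> Poly_Mapping.keys p" "k \<in> Poly_Mapping.keys m"
    then have "k \<in> V" using assms by (auto simp: poly_vars_def)
    then show "(if k \<in> V then Var k else 0) ^ Poly_Mapping.lookup m k =
        Var k ^ Poly_Mapping.lookup m k" by simp
  qed
  then show ?thesis by (simp add: subst_poly_Var_id)
qed

text \<open>A cofactor given by divisibility may involve foreign variables. Setting these to 0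
  changes neither \<open>p\<close> nor \<open>lin i j\<close>, and moves the cofactor into
  \<open>V\<close>.\<close>

lemma lin_dvdE_vars:
  assumes "lin i j dvd p" "poly_vars p \<subseteq> V" "i \<in> V" "j \<in> V"
  obtains q where "p = lin i j * q" "poly_vars q \<subseteq> V"
proof -
  obtain r where "p = lin i j * r" using assms(1) by auto
  then have "restrict_vars V p = restrict_vars V (lin i j) * restrict_vars V r"
    by (simp add: subst_poly_mult)
  then have "p = lin i j * restrict_vars V r"
    using assms poly_vars_lin[of i j] restrict_vars_id[of p V] restrict_vars_id[of "lin i j" V]
    by auto
  then show ?thesis using that poly_vars_restrict_vars by blast
qed

lemma poly_fract_0 [simp]: "poly_fract 0 = 0"
  by (simp add: poly_fract_def fract_collapse)

lemma poly_fract_1 [simp]: "poly_fract 1 = 1"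
  by (simp add: poly_fract_def fract_collapse)

lemma poly_fract_add: "poly_fract (p + q) = poly_fract p + poly_fract q"
  by (simp add: poly_fract_def)

lemma poly_fract_mult: "poly_fract (p * q) = poly_fract p * poly_fract q"
  by (simp add: poly_fract_def)

lemma poly_fract_minus: "poly_fract (- p) = - poly_fract p"
  by (simp add: poly_fract_def)

lemma poly_fract_diff: "poly_fract (p - q) = poly_fract p - poly_fract q"
  by (simp add: poly_fract_def)

lemma poly_fract_eq_iff [simp]: "poly_fract p = poly_fract q \<longleftrightarrow> p = q"
  by (simp add: poly_fract_def eq_fract)

lemma indet_diff: "indet i - indet j = poly_fract (lin i j)"
  by (simp add: indet_def lin_def poly_fract_diff Var_def)

lemma indet_eq_iff [simp]: "indet i = (indet j :: 'k::field mpoly fract) \<longleftrightarrow> i = j"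
  unfolding indet_def poly_fract_eq_iff Var_def[symmetric] by simp

section \<open>Poles along hyperplanes\<close>

text \<open>The local ring of the rational function field at the prime element \<open>x\<^sub>i - x\<^sub>j\<close>.\<close>

definition regular_along :: "nat \<Rightarrow> nat \<Rightarrow> 'k::field mpoly fract set" where
  "regular_along i j =
     {F. \<exists>f g. \<not> lin i j dvd g \<and> F * poly_fract g = poly_fract f}"

lemma regular_along_poly [simp]: "poly_fract p \<in> regular_along i j"
  unfolding regular_along_def using not_lin_dvd_1[of i j]
  by (intro CollectI exI[of _ p] exI[of _ 1]) simp

lemma regular_along_indet_diff [simp]: "indet a - indet b \<in> regular_along i j"
  by (simp add: indet_diff)

lemma regular_along_0 [simp]: "0 \<in> regular_along i j"
  and regular_along_1 [simp]: "1 \<in> regular_along i j"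
  using regular_along_poly[of 0] regular_along_poly[of 1] by simp_all

lemma regular_along_add:
  assumes "F \<in> regular_along i j" "G \<in> regular_along i j"
  shows "F + G \<in> regular_along i j"
proof -
  obtain f g f' g' where "\<not> lin i j dvd g" "F * poly_fract g = poly_fract f"
      "\<not> lin i j dvd g'" "G * poly_fract g' = poly_fract f'"
    using assms by (auto simp: regular_along_def)
  then have "\<not> lin i j dvd g * g'"
      "(F + G) * poly_fract (g * g') = poly_fract (f * g' + f' * g)"
    by (simp_all add: lin_dvd_mult_iff poly_fract_mult poly_fract_add algebra_simps)
  then show ?thesis unfolding regular_along_def by blast
qed

lemma regular_along_mult:
  assumes "F \<in> regular_along i j" "G \<in> regular_along i j"
  shows "F * G \<in> regular_along i j"
proof -
  obtain f g f' g' where *: "\<not> lin i j dvd g" "F * poly_fract g = poly_fract f"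
      "\<not> lin i j dvd g'" "G * poly_fract g' = poly_fract f'"
    using assms by (auto simp: regular_along_def)
  have "F * G * poly_fract (g * g') = (F * poly_fract g) * (G * poly_fract g')"
    by (simp add: poly_fract_mult)
  also have "\<dots> = poly_fract (f * f')"
    using * by (simp add: poly_fract_mult)
  finally have "\<not> lin i j dvd g * g'" "F * G * poly_fract (g * g') = poly_fract (f * f')"
    using * by (simp_all add: lin_dvd_mult_iff)
  then show ?thesis unfolding regular_along_def by blast
qed

lemma regular_along_minus:
  assumes "F \<in> regular_along i j"
  shows "- F \<in> regular_along i j"
proof -
  have "poly_fract (- 1) * F \<in> regular_along i j"
    using assms by (intro regular_along_mult regular_along_poly)
  moreover have "poly_fract (- 1) * F = - F"
    by (simp add: poly_fract_minus)
  ultimately show ?thesis by simp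
qed

lemma regular_along_commute: "regular_along i j = regular_along j i"
proof -
  have "lin j i = - (lin i j :: 'a mpoly)" by (simp add: lin_def)
  then show ?thesis by (simp add: regular_along_def)
qed

text \<open>The linear form of any other hyperplane is a unit of the local ring.\<close>

lemma regular_along_inverse:
  assumes "a \<noteq> b" "{a, b} \<noteq> {i, j}"
  shows "inverse (indet a - indet b) \<in> regular_along i j"
proof -
  have "\<not> lin i j dvd lin a b"
    by (rule not_lin_dvd_lin[OF assms])
  moreover have "inverse (indet a - indet b) * poly_fract (lin a b) = poly_fract 1"
    using assms(1) by (simp flip: indet_diff)
  ultimately show ?thesis unfolding regular_along_def by blast
qed

lemma regular_along_sum:
  "(\<And>x. x \<in> A \<Longrightarrow> F x \<in> regular_along i j) \<Longrightarrow> sum F A \<in> regular_along i j"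
  by (induction A rule: infinite_finite_induct) (auto intro: regular_along_add)

lemma regular_along_prod:
  "(\<And>x. x \<in> A \<Longrightarrow> F x \<in> regular_along i j) \<Longrightarrow> prod F A \<in> regular_along i j"
  by (induction A rule: infinite_finite_induct) (auto intro: regular_along_mult)

text \<open>A list and not a set of pairs, since multiplying denominators repeats factors.\<close>

definition lin_product :: "(nat \<times> nat) list \<Rightarrow> 'k::field mpoly" where
  "lin_product ps = (\<Prod>(a, b)\<leftarrow>ps. lin a b)"

text \<open>Rational functions in the variables from \<open>V\<close> whose poles lie on the hyperplanes
  \<open>x\<^sub>a = x\<^sub>b\<close>.\<close>

definition braid_functions :: "nat set \<Rightarrow> 'k::field mpoly fract set" where
  "braid_functions V = {F. \<exists>p ps. poly_vars p \<subseteq> V \<and>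
     (\<forall>(a, b)\<in>set ps. a \<in> V \<and> b \<in> V \<and> a \<noteq> b) \<and>
     F * poly_fract (lin_product ps) = poly_fract p}"

lemma lin_product_append: "lin_product (ps @ qs) = lin_product ps * lin_product qs"
  by (simp add: lin_product_def)

lemma poly_vars_lin_product:
  assumes "\<forall>(a, b)\<in>set ps. a \<in> V \<and> b \<in> V \<and> a \<noteq> b"
  shows "poly_vars (lin_product ps :: 'k::field mpoly) \<subseteq> V"
  using assms
proof (induction ps)
  case (Cons e ps)
  obtain a b where e: "e = (a, b)" by force
  have "poly_vars (lin a b * lin_product ps :: 'k mpoly) \<subseteq> V"
    using poly_vars_mult[of "lin a b :: 'k mpoly" "lin_product ps"]
      poly_vars_lin[of a b, where 'a = 'k] Cons e by auto
  then show ?case by (simp add: lin_product_def e)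
qed (simp add: lin_product_def)

lemma braid_functions_poly:
  "poly_vars p \<subseteq> V \<Longrightarrow> poly_fract p \<in> braid_functions V"
  unfolding braid_functions_def
  by (intro CollectI exI[of _ p] exI[of _ "[]"]) (simp add: lin_product_def)

lemma braid_functions_add:
  assumes "F \<in> braid_functions V" "G \<in> braid_functions V"
  shows "F + G \<in> braid_functions V"
proof -
  obtain p ps q qs where *: "poly_vars p \<subseteq> V" "\<forall>(a, b)\<in>set ps. a \<in> V \<and> b \<in> V \<and> a \<noteq> b"
      "F * poly_fract (lin_product ps) = poly_fract p" "poly_vars q \<subseteq> V"
      "\<forall>(a, b)\<in>set qs. a \<in> V \<and> b \<in> V \<and> a \<noteq> b" "G * poly_fract (lin_product qs) = poly_fract q"
    using assms by (auto simp: braid_functions_def)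
  have "(F + G) * poly_fract (lin_product (ps @ qs)) =
      (F * poly_fract (lin_product ps)) * poly_fract (lin_product qs) +
      (G * poly_fract (lin_product qs)) * poly_fract (lin_product ps)"
    by (simp add: lin_product_append poly_fract_mult algebra_simps)
  also have "\<dots> = poly_fract (p * lin_product qs + q * lin_product ps)"
    unfolding *(3,6) by (simp add: poly_fract_mult poly_fract_add)
  finally have "(F + G) * poly_fract (lin_product (ps @ qs)) =
      poly_fract (p * lin_product qs + q * lin_product ps)" .
  moreover have "poly_vars (p * lin_product qs + q * lin_product ps) \<subseteq> V"
    using poly_vars_add[of "p * lin_product qs" "q * lin_product ps"]
      poly_vars_mult[of p "lin_product qs"] poly_vars_mult[of q "lin_product ps"]
      poly_vars_lin_product[OF *(2)] poly_vars_lin_product[OF *(5)] * by blast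
  moreover have "\<forall>(a, b)\<in>set (ps @ qs). a \<in> V \<and> b \<in> V \<and> a \<noteq> b"
    using * by auto
  ultimately show ?thesis unfolding braid_functions_def by blast
qed

lemma braid_functions_mult:
  assumes "F \<in> braid_functions V" "G \<in> braid_functions V"
  shows "F * G \<in> braid_functions V"
proof -
  obtain p ps q qs where *: "poly_vars p \<subseteq> V" "\<forall>(a, b)\<in>set ps. a \<in> V \<and> b \<in> V \<and> a \<noteq> b"
      "F * poly_fract (lin_product ps) = poly_fract p" "poly_vars q \<subseteq> V"
      "\<forall>(a, b)\<in>set qs. a \<in> V \<and> b \<in> V \<and> a \<noteq> b" "G * poly_fract (lin_product qs) = poly_fract q"
    using assms by (auto simp: braid_functions_def)
  have "(F * G) * poly_fract (lin_product (ps @ qs)) =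
      (F * poly_fract (lin_product ps)) * (G * poly_fract (lin_product qs))"
    by (simp add: lin_product_append poly_fract_mult)
  also have "\<dots> = poly_fract (p * q)"
    unfolding *(3,6) by (simp add: poly_fract_mult)
  finally have "(F * G) * poly_fract (lin_product (ps @ qs)) = poly_fract (p * q)" .
  moreover have "poly_vars (p * q) \<subseteq> V"
    using poly_vars_mult[of p q] * by blast
  moreover have "\<forall>(a, b)\<in>set (ps @ qs). a \<in> V \<and> b \<in> V \<and> a \<noteq> b"
    using * by auto
  ultimately show ?thesis unfolding braid_functions_def by blast
qed

lemma braid_functions_0 [simp]: "0 \<in> braid_functions V"
  and braid_functions_1 [simp]: "1 \<in> braid_functions V"
  using braid_functions_poly[of 0 V] braid_functions_poly[of 1 V] by simp_all

lemma braid_functions_indet_diff: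
  "a \<in> V \<Longrightarrow> b \<in> V \<Longrightarrow> indet a - indet b \<in> braid_functions V"
  unfolding indet_diff using poly_vars_lin[of a b] by (auto intro!: braid_functions_poly)

lemma braid_functions_inverse:
  assumes "a \<in> V" "b \<in> V"
  shows "inverse (indet a - indet b) \<in> braid_functions V"
proof (cases "a = b")
  case False
  then show ?thesis unfolding braid_functions_def
    by (intro CollectI exI[of _ 1] exI[of _ "[(a, b)]"])
      (use assms in \<open>auto simp: lin_product_def simp flip: indet_diff\<close>)
qed simp

lemma braid_functions_sum:
  "(\<And>x. x \<in> A \<Longrightarrow> F x \<in> braid_functions V) \<Longrightarrow> sum F A \<in> braid_functions V"
  by (induction A rule: infinite_finite_induct) (auto intro: braid_functions_add)

lemma braid_functions_prod:
  "(\<And>x. x \<in> A \<Longrightarrow> F x \<in> braid_functions V) \<Longrightarrow> prod F A \<in> braid_functions V"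
  by (induction A rule: infinite_finite_induct) (auto intro: braid_functions_mult)

text \<open>The factors of the denominator are removed one by one. Regularity along the head factor
  gives F g = f with \<open>g\<close> prime to it; clearing denominators yields p g =
  \<open>lin i j\<close> f r, so primality puts the head factor into \<open>p\<close>, where it
  cancels.\<close>

lemma braid_function_regular_imp_poly:
  fixes F :: "'k::field mpoly fract"
  assumes "F \<in> braid_functions V"
    and reg: "\<And>i j. i \<in> V \<Longrightarrow> j \<in> V \<Longrightarrow> i \<noteq> j \<Longrightarrow> F \<in> regular_along i j"
  shows "\<exists>p. poly_vars p \<subseteq> V \<and> F = poly_fract p"
proof -
  obtain p ps where "poly_vars p \<subseteq> V" "\<forall>(a, b)\<in>set ps. a \<in> V \<and> b \<in> V \<and> a \<noteq> b"
      "F * poly_fract (lin_product ps) = poly_fract p"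
    using assms(1) by (auto simp: braid_functions_def)
  then show ?thesis
  proof (induction ps arbitrary: p)
    case Nil
    then show ?case by (auto simp: lin_product_def)
  next
    case (Cons e ps)
    obtain i j where e: "e = (i, j)" by force
    have ij: "i \<in> V" "j \<in> V" "i \<noteq> j" using Cons.prems e by auto
    define r :: "'k mpoly" where r: "r = lin_product ps"
    obtain f g where fg: "\<not> lin i j dvd g" "F * poly_fract g = poly_fract f"
      using reg[OF ij] by (auto simp: regular_along_def)
    have p: "F * (poly_fract (lin i j) * poly_fract r) = poly_fract p"
      using Cons.prems(3) by (simp add: r lin_product_def e poly_fract_mult)
    have "poly_fract (p * g) = (F * poly_fract g) * (poly_fract (lin i j) * poly_fract r)"
      unfolding poly_fract_mult p[symmetric] by (simp add: mult_ac)
    also have "\<dots> = poly_fract (lin i j * (f * r))"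
      unfolding fg(2) by (simp add: poly_fract_mult mult_ac)
    finally have "p * g = lin i j * (f * r)"
      by (simp only: poly_fract_eq_iff)
    then have "lin i j dvd p * g" by simp
    then have "lin i j dvd p"
      using fg(1) by (simp add: lin_dvd_mult_iff)
    then obtain q where q: "p = lin i j * q" "poly_vars q \<subseteq> V"
      using lin_dvdE_vars Cons.prems(1) ij by metis
    have "poly_fract (lin i j :: 'k mpoly) \<noteq> 0"
      using ij(3) by (simp flip: indet_diff)
    moreover have "poly_fract (lin i j) * (F * poly_fract r) = poly_fract (lin i j) * poly_fract q"
      using p q(1) by (simp add: poly_fract_mult mult_ac)
    ultimately have "F * poly_fract (lin_product ps) = poly_fract q"
      using r by simp
    then show ?case
      using Cons.IH[OF q(2)] Cons.prems(2) by auto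
  qed
qed

section \<open>Cyclic words\<close>

fun chain :: "nat list \<Rightarrow> 'k::field mpoly fract" where
  "chain (x # y # zs) = (indet x - indet y) * chain (y # zs)"
| "chain _ = 1"

text \<open>The letter at the cut is kept in both pieces, so that no difference is lost.\<close>

lemma chain_append: "chain (xs @ y # ys) = chain (xs @ [y]) * chain (y # ys)"
  by (induction xs rule: chain.induct) auto

lemma chain_conv_prod: "chain ys = (\<Prod>k<length ys - 1. indet (ys ! k) - indet (ys ! Suc k))"
proof (induction ys rule: chain.induct)
  case (1 x y zs)
  then show ?case
    by (simp add: prod.lessThan_Suc_shift del: prod.lessThan_Suc)
qed simp_all

lemma Psi_word_conv_chain:
  assumes "w \<noteq> []"
  shows "(Psi_word w :: 'k::field mpoly fract) = 1 / chain (w @ [hd w])"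
proof -
  \<comment> \<open>The index \<open>Suc k mod length w\<close> wraps only at the last position,
    where the appended first letter stands.\<close>
  have "(w @ [hd w]) ! k = w ! k" "(w @ [hd w]) ! Suc k = w ! (Suc k mod length w)"
    if "k < length w" for k
    using that assms by (cases "Suc k = length w"; simp add: nth_append hd_conv_nth)+
  then have "(chain (w @ [hd w]) :: 'k mpoly fract) =
      (\<Prod>k<length w. indet (w ! k) - indet (w ! (Suc k mod length w)))"
    unfolding chain_conv_prod by (intro prod.cong) simp_all
  then show ?thesis by (simp add: Psi_word_def)
qed

lemma Psi_word_rotate1 [simp]: "Psi_word (rotate1 w) = Psi_word w"
proof (cases w)
  case (Cons x xs)
  show ?thesis
  proof (cases xs)
    case (Cons y ys)
    then have "Psi_word (rotate1 w) = 1 / chain ((y # ys) @ x # [y])"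
      using \<open>w = x # xs\<close> by (simp add: Psi_word_conv_chain)
    also have "\<dots> = 1 / (chain ((y # ys) @ [x]) * (indet x - indet y))"
      by (subst chain_append) simp
    also have "\<dots> = Psi_word w"
      using \<open>w = x # xs\<close> Cons by (simp add: Psi_word_conv_chain mult.commute)
    finally show ?thesis .
  qed (use Cons in simp)
qed simp

lemma Psi_word_rotate [simp]: "Psi_word (rotate k w) = Psi_word w"
  by (induction k) auto

lemma Psi_order_rotation_class: "Psi_order (rotation_class w) = Psi_word w"
proof -
  have "(SOME u. u \<in> rotation_class w) \<in> rotation_class w"
    by (rule someI[of _ w]) (auto simp: rotation_class_def intro: exI[of _ 0])
  then show ?thesis by (auto simp: Psi_order_def rotation_class_def)
qed

lemma braid_functions_chain_inverse:
  "set ys \<subseteq> V \<Longrightarrow> inverse (chain ys) \<in> braid_functions V"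
  by (induction ys rule: chain.induct)
    (auto intro!: braid_functions_mult braid_functions_inverse simp: inverse_mult_distrib)

lemma braid_functions_Psi_word:
  assumes "set w \<subseteq> V"
  shows "Psi_word w \<in> braid_functions V"
proof (cases "w = []")
  case True
  then show ?thesis by (simp add: Psi_word_def)
next
  case False
  then have "set (w @ [hd w]) \<subseteq> V" using assms by auto
  from braid_functions_chain_inverse[OF this] show ?thesis
    using False by (simp add: Psi_word_conv_chain divide_inverse)
qed

lemma regular_along_chain_inverse:
  assumes "successively (\<lambda>a b. a \<noteq> b \<and> {a, b} \<noteq> {i, j}) ys"
  shows "inverse (chain ys) \<in> regular_along i j"
  using assms
  by (induction ys rule: chain.induct)
    (auto intro!: regular_along_mult regular_along_inverse simp: inverse_mult_distrib)

lemma regular_along_Psi_word: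
  assumes "successively (\<lambda>a b. a \<noteq> b \<and> {a, b} \<noteq> {i, j}) (w @ [hd w])"
  shows "Psi_word w \<in> regular_along i j"
proof (cases "w = []")
  case False
  then show ?thesis
    using regular_along_chain_inverse[OF assms] by (simp add: Psi_word_conv_chain divide_inverse)
qed (simp add: Psi_word_def)

text \<open>Isolates the factors that involve \<open>i\<close> or \<open>j\<close>, which are the
  only ones affected by swapping the two letters.\<close>

lemma Psi_word_Cons_Cons:
  assumes "v \<noteq> []"
  shows "(Psi_word (i # j # v) :: 'k::field mpoly fract) =
    1 / ((indet i - indet j) * (indet j - indet (hd v)) * chain v * (indet (last v) - indet i))"
proof -
  obtain b v' where v: "v = b # v'" using assms by (cases v) auto
  have "v @ [i] = butlast v @ last v # [i]"
    using append_butlast_last_id[OF assms] by (metis append_assoc append_Cons append_Nil)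
  then have "(chain (v @ [i]) :: 'k mpoly fract) = chain (butlast v @ last v # [i])"
    by (rule arg_cong)
  also have "\<dots> = chain v * (indet (last v) - indet i)"
    using assms by (subst chain_append) simp
  finally have "(chain (v @ [i]) :: 'k mpoly fract) = chain v * (indet (last v) - indet i)" .
  then show ?thesis by (simp add: Psi_word_conv_chain v)
qed

lemma successively_distinct_avoiding:
  assumes "distinct v" "i \<notin> set v"
  shows "successively (\<lambda>a b. a \<noteq> b \<and> {a, b} \<noteq> {i, j}) v"
  using assms by (induction v rule: induct_list012) (auto simp: doubleton_eq_iff)

text \<open>With a letter between \<open>j\<close> and the return to \<open>i\<close>, the factor at
  \<open>{i, j}\<close> occurs once and the others are units. An empty \<open>v\<close> would bring
  back x_j - x_i and a double pole.\<close>

lemma regular_along_simple_pole: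
  assumes "distinct (i # j # v)" "v \<noteq> []"
  shows "(Psi_word (i # j # v) * (indet i - indet j) :: 'k::field mpoly fract) \<in> regular_along i j"
proof -
  have *: "inverse (indet j - indet (hd v)) \<in> regular_along i j"
      "inverse (indet (last v) - indet i) \<in> regular_along i j"
      "inverse (chain v) \<in> regular_along i j"
    using assms hd_in_set[of v] last_in_set[of v]
    by (auto intro!: regular_along_inverse regular_along_chain_inverse
        successively_distinct_avoiding simp: doubleton_eq_iff)
  have pole: "1 / (d * b * c * e) * d = inverse b * inverse c * inverse e"
    if "d \<noteq> 0" for b c d e :: "'k mpoly fract"
    using that by (simp add: divide_simps)
  have "(Psi_word (i # j # v) * (indet i - indet j) :: 'k mpoly fract) =
      inverse (indet j - indet (hd v)) * inverse (chain v) * inverse (indet (last v) - indet i)"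
    unfolding Psi_word_Cons_Cons[OF assms(2)] by (rule pole) (use assms(1) in auto)
  also have "\<dots> \<in> regular_along i j"
    using * by (intro regular_along_mult)
  finally show ?thesis .
qed

text \<open>Near x_i = x_j the two summands have opposite residues; over a common denominator the
  numerator acquires the factor x_i - x_j.\<close>

lemma regular_along_swap:
  assumes "distinct (i # j # v)" "v \<noteq> []"
  shows "(Psi_word (i # j # v) + Psi_word (j # i # v) :: 'k::field mpoly fract) \<in> regular_along i j"
proof -
  define a b where "a = last v" and "b = hd v"
  have ab: "a \<in> set v" "b \<in> set v"
    using assms(2) by (auto simp: a_def b_def)
  have *: "inverse (indet j - indet b) \<in> regular_along i j"
      "inverse (indet i - indet b) \<in> regular_along i j"
      "inverse (indet a - indet i) \<in> regular_along i j"
      "inverse (indet a - indet j) \<in> regular_along i j"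
      "inverse (chain v) \<in> regular_along i j"
    using assms ab
    by (auto intro!: regular_along_inverse regular_along_chain_inverse
        successively_distinct_avoiding simp: doubleton_eq_iff)
  have partial_fractions:
    "1 / ((x - y) * (y - t) * c * (s - x)) + 1 / ((y - x) * (x - t) * c * (s - y)) =
       (s - t) * inverse c * inverse (y - t) * inverse (x - t) * inverse (s - x) * inverse (s - y)"
    if "x \<noteq> y" "y \<noteq> t" "x \<noteq> t" "s \<noteq> x" "s \<noteq> y" for x y s t c :: "'k mpoly fract"
  \<comment> \<open>Division by 0 gives 0, so for c = 0 both sides vanish; this avoids proving
    \<open>chain v\<close> nonzero.\<close>
  proof (cases "c = 0")
    case False
    have nz: "x - y \<noteq> 0" "y - t \<noteq> 0" "x - t \<noteq> 0" "s - x \<noteq> 0" "s - y \<noteq> 0" using that by auto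
    have "1 / ((x - y) * (y - t) * c * (s - x)) + 1 / ((y - x) * (x - t) * c * (s - y)) =
        1 / ((x - y) * (y - t) * c * (s - x)) - 1 / ((x - y) * (x - t) * c * (s - y))"
    proof -
      have "(y - x) * (x - t) * c * (s - y) = - ((x - y) * (x - t) * c * (s - y))"
        by (simp add: algebra_simps)
      then show ?thesis by simp
    qed
    also have "\<dots> = ((x - t) * (s - y) - (y - t) * (s - x)) /
        ((x - y) * c * (y - t) * (x - t) * (s - x) * (s - y))"
      using nz False by (simp add: divide_simps)
    \<comment> \<open>This factor x - y of the numerator cancels the pole.\<close>
    also have "(x - t) * (s - y) - (y - t) * (s - x) = (x - y) * (s - t)"
      by (simp add: algebra_simps)
    finally show ?thesis
      using nz False by (simp add: divide_simps)
  qed simp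
  have "(Psi_word (i # j # v) + Psi_word (j # i # v) :: 'k mpoly fract) =
      (indet a - indet b) * inverse (chain v) * inverse (indet j - indet b) *
      inverse (indet i - indet b) * inverse (indet a - indet i) * inverse (indet a - indet j)"
    unfolding Psi_word_Cons_Cons[OF assms(2)] a_def[symmetric] b_def[symmetric]
    by (rule partial_fractions) (use assms(1) ab in auto)
  also have "\<dots> \<in> regular_along i j"
    using * by (intro regular_along_mult regular_along_indet_diff)
  finally show ?thesis .
qed

text \<open>The head letter occupies a single position, so the rotation amount is 0 modulo the
  length.\<close>

lemma rotate_eq_if_hd_eq:
  assumes "distinct w" "hd (rotate k w) = hd w"
  shows "rotate k w = w"
proof (cases "w = []")
  case False
  then have "w ! (k mod length w) = w ! 0"
    using assms(2) by (metis hd_rotate_conv_nth hd_conv_nth)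
  then have "k mod length w = 0"
    using assms(1) False by (simp add: nth_eq_iff_index_eq)
  then show ?thesis by simp
qed simp

section \<open>Toric classes and acyclic orientations\<close>

lemma flip_flip [simp]: "flip k (flip k Q) = Q"
  by (auto simp: flip_def)

lemma is_source_flip: "is_source (flip k Q) k \<longleftrightarrow> is_sink Q k"
  and is_sink_flip: "is_sink (flip k Q) k \<longleftrightarrow> is_source Q k"
  by (simp_all add: is_source_def is_sink_def flip_def)

text \<open>The same vertex flips back, with the roles of source and sink exchanged.\<close>

lemma flip_step_sym: "flip_step n Q Q' \<Longrightarrow> flip_step n Q' Q"
  unfolding flip_step_def using is_source_flip is_sink_flip flip_flip by metis

lemma toric_class_self: "Q \<in> toric_class n Q"
  by (simp add: toric_class_def)

lemma toric_class_step: "Q' \<in> toric_class n Q \<Longrightarrow> flip_step n Q' Q'' \<Longrightarrow> Q'' \<in> toric_class n Q"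
  unfolding toric_class_def by auto

lemma flip_rtranclp_sym: "(flip_step n)\<^sup>*\<^sup>* Q Q' \<Longrightarrow> (flip_step n)\<^sup>*\<^sup>* Q' Q"
  by (rule sympD[OF symp_rtranclp[OF sympI[OF flip_step_sym]]])

lemma toric_class_eq:
  assumes "Q' \<in> toric_class n Q"
  shows "toric_class n Q' = toric_class n Q"
proof -
  have Q': "(flip_step n)\<^sup>*\<^sup>* Q Q'"
    using assms by (simp add: toric_class_def)
  have "(flip_step n)\<^sup>*\<^sup>* Q' R \<longleftrightarrow> (flip_step n)\<^sup>*\<^sup>* Q R" for R
    using rtranclp_trans[OF Q'] rtranclp_trans[OF flip_rtranclp_sym[OF Q']] by (rule iffI)
  then show ?thesis
    by (simp add: toric_class_def)
qed

lemma flip_edge_iff: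
  "(a, b) \<in> flip k Q \<or> (b, a) \<in> flip k Q \<longleftrightarrow> (a, b) \<in> Q \<or> (b, a) \<in> Q"
  by (auto simp: flip_def)

lemma toric_class_edge_iff:
  assumes "Q' \<in> toric_class n Q"
  shows "(a, b) \<in> Q' \<or> (b, a) \<in> Q' \<longleftrightarrow> (a, b) \<in> Q \<or> (b, a) \<in> Q"
proof -
  have "(flip_step n)\<^sup>*\<^sup>* Q Q'"
    using assms by (simp add: toric_class_def)
  then show ?thesis
  proof (induction rule: rtranclp_induct)
    case (step Q1 Q2)
    then obtain k where "Q2 = flip k Q1"
      by (auto simp: flip_step_def)
    then show ?case
      using step.IH by (simp only: flip_edge_iff)
  qed simp
qed

lemma underlying_graph_toric_class_iff:
  "{a, b} \<in> underlying_graph (toric_class n Q) \<longleftrightarrow> (a, b) \<in> Q \<or> (b, a) \<in> Q"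
proof -
  have "{a, b} \<in> underlying_graph (toric_class n Q) \<longleftrightarrow>
      (\<exists>Q'\<in>toric_class n Q. (a, b) \<in> Q' \<or> (b, a) \<in> Q')"
    unfolding underlying_graph_def mem_Collect_eq doubleton_eq_iff by blast
  also have "\<dots> \<longleftrightarrow> (\<exists>Q'\<in>toric_class n Q. (a, b) \<in> Q \<or> (b, a) \<in> Q)"
    by (rule bex_cong[OF refl]) (rule toric_class_edge_iff)
  also have "\<dots> \<longleftrightarrow> (a, b) \<in> Q \<or> (b, a) \<in> Q"
    using toric_class_self[of Q n] by blast
  finally show ?thesis .
qed

text \<open>The last two conclusions concern undirected edges only. Flips preserve these, so both
  pass from the acyclic base quiver to every member.\<close>

lemma toric_poset_memD:
  assumes "toric_poset n P" "Q \<in> P"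
  shows "P = toric_class n Q" "Q \<subseteq> {1..n} \<times> {1..n}" "(a, a) \<notin> Q"
proof -
  obtain Q0 where Q0: "acyclic_quiver n Q0" "P = toric_class n Q0"
    using assms(1) by (auto simp: toric_poset_def)
  show "P = toric_class n Q"
    using Q0(2) assms(2) by (simp add: toric_class_eq)
  have *: "(a, b) \<in> Q \<or> (b, a) \<in> Q \<longleftrightarrow> (a, b) \<in> Q0 \<or> (b, a) \<in> Q0" for a b
    using toric_class_edge_iff[of Q n Q0 a b] Q0(2) assms(2) by simp
  show "(a, a) \<notin> Q"
    using *[of a a] Q0(1) by (auto simp: acyclic_quiver_def acyclic_def)
  show "Q \<subseteq> {1..n} \<times> {1..n}"
  proof
    fix e assume "e \<in> Q"
    then show "e \<in> {1..n} \<times> {1..n}"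
      using *[of "fst e" "snd e"] Q0(1) unfolding acyclic_quiver_def by (cases e) auto
  qed
qed

section \<open>Orientations induced by words\<close>

fun idx :: "'a list \<Rightarrow> 'a \<Rightarrow> nat" where
  "idx [] a = 0"
| "idx (x # xs) a = (if x = a then 0 else Suc (idx xs a))"

lemma idx_less_length: "idx w a < length w \<longleftrightarrow> a \<in> set w"
  by (induction w) auto

text \<open>The default for an absent letter thus exceeds every actual position.\<close>

lemma idx_eq_length: "a \<notin> set w \<Longrightarrow> idx w a = length w"
  by (induction w) auto

lemma nth_idx [simp]: "a \<in> set w \<Longrightarrow> w ! idx w a = a"
  by (induction w) auto

lemma idx_nth: "distinct w \<Longrightarrow> k < length w \<Longrightarrow> idx w (w ! k) = k"
  by (metis idx_less_length nth_eq_iff_index_eq nth_idx nth_mem)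

lemma idx_append: "idx (xs @ ys) a = (if a \<in> set xs then idx xs a else length xs + idx ys a)"
  by (induction xs) auto

text \<open>The combinatorial counterpart of \<open>torus_orientation\<close>, with positions in
  place of coordinates.\<close>

definition orient :: "nat set set \<Rightarrow> nat list \<Rightarrow> (nat \<times> nat) set" where
  "orient G w = {(a, b). {a, b} \<in> G \<and> idx w a < idx w b}"

text \<open>The first letter precedes all its neighbours; moved to the end it follows them all, and
  no other pair changes its order.\<close>

lemma orient_rotate1:
  assumes "distinct w" "\<And>a b. {a, b} \<in> G \<Longrightarrow> a \<in> set w \<and> b \<in> set w" "w \<noteq> []"
  shows "orient G (rotate1 w) = flip (hd w) (orient G w)" "is_source (orient G w) (hd w)"
proof -
  obtain x xs where w: "w = x # xs" using assms(3) by (cases w) auto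
  have x: "x \<notin> set xs" using assms(1) w by auto
  have in_xs: "a \<in> set xs" if "{a, b} \<in> G" "a \<noteq> x" for a b
    using assms(2)[OF that(1)] that(2) w by auto
  show "is_source (orient G w) (hd w)"
    by (simp add: is_source_def orient_def w)
  have "(a, b) \<in> orient G (rotate1 w) \<longleftrightarrow> (a, b) \<in> flip x (orient G w)" for a b
  proof (cases "{a, b} \<in> G")
    case True
    then have "a \<in> set xs \<or> a = x" "b \<in> set xs \<or> b = x" "{b, a} \<in> G"
      using in_xs[of a b] in_xs[of b a] by (auto simp: insert_commute)
    moreover have "c \<in> set xs \<Longrightarrow> idx xs c < length xs" "\<not> length xs < idx xs c" for c
      using idx_less_length[of xs c] idx_eq_length[of c xs] by fastforce+
    ultimately show ?thesis
      using x True by (auto simp: orient_def w idx_append flip_def)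
  qed (auto simp: orient_def flip_def insert_commute)
  then show "orient G (rotate1 w) = flip (hd w) (orient G w)"
    by (auto simp: w)
qed

lemma orient_rotate_mem:
  assumes "distinct w" "set w = {1..n}" "\<And>a b. {a, b} \<in> G \<Longrightarrow> a \<in> {1..n} \<and> b \<in> {1..n}"
    and "orient G w \<in> toric_class n Q"
  shows "orient G (rotate k w) \<in> toric_class n Q"
proof (induction k)
  case (Suc k)
  let ?w = "rotate k w"
  show ?case
  proof (cases "w = []")
    case False
    have "orient G (rotate1 ?w) = flip (hd ?w) (orient G ?w)" "is_source (orient G ?w) (hd ?w)"
      using orient_rotate1[of ?w G] assms(1,2,3) False by simp_all
    moreover have "hd ?w \<in> {1..n}"
      using hd_in_set[of ?w] assms(2) False by simp
    ultimately have "flip_step n (orient G ?w) (orient G (rotate (Suc k) w))"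
      unfolding flip_step_def by auto
    then show ?thesis using Suc toric_class_step by blast
  qed (use assms(4) in simp)
qed (use assms(4) in simp)

text \<open>Only the mutual order of \<open>i\<close> and \<open>j\<close> changes, and a non-edge
  does not record it.\<close>

lemma orient_swap:
  assumes "{i, j} \<notin> G" "i \<noteq> j"
  shows "orient G (i # j # v) = orient G (j # i # v)"
  using assms by (auto simp: orient_def insert_commute)

section \<open>From torus points to words\<close>

lemma coord_torus_proj:
  assumes "x \<in> real_space n" "i \<in> {1..n}"
  shows "coord (torus_proj n x) i = frac (x i)"
proof -
  define y where "y = (SOME y. y \<in> torus_proj n x)"
  have "x \<in> torus_proj n x"
    using assms by (simp add: torus_proj_def torus_rel_def)
  then have "y \<in> torus_proj n x"
    unfolding y_def by (rule someI[of "\<lambda>y. y \<in> torus_proj n x"])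
  then have "x i - y i \<in> \<int>"
    using assms(2) by (simp add: torus_proj_def torus_rel_def)
  then obtain m where "x i = y i + of_int m"
    by (metis Ints_cases add.commute diff_add_cancel)
  then have "frac (x i) = frac (y i)"
    by (simp add: frac_def)
  then show ?thesis by (simp add: coord_def y_def)
qed

lemma torus_orientation_sorted:
  assumes "sorted_wrt (\<lambda>i j. coord p i < coord p j) w"
    and "\<And>a b. {a, b} \<in> G \<Longrightarrow> a \<in> set w \<and> b \<in> set w"
  shows "torus_orientation G p = orient G w"
proof -
  have less: "coord p a < coord p b" if "idx w a < idx w b" "a \<in> set w" "b \<in> set w" for a b
    using sorted_wrt_nth_less[OF assms(1) that(1)] that by (simp add: idx_less_length)
  have "coord p a < coord p b \<longleftrightarrow> idx w a < idx w b" if "a \<in> set w" "b \<in> set w" for a b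
    using less[of a b] less[of b a] that nth_idx[of a w] nth_idx[of b w]
    by (metis less_asym less_irrefl linorder_neqE_nat)
  then show ?thesis
    unfolding torus_orientation_def orient_def using assms(2) by blast
qed

text \<open>Order chambers are nonempty, so an inclusion of chambers can be tested at a
  point.\<close>

lemma exists_torus_point_sorted:
  assumes "distinct w" "set w = {1..n}"
  shows "\<exists>p\<in>torus n. inj_on (coord p) {1..n} \<and> sorted_wrt (\<lambda>i j. coord p i < coord p j) w"
proof -
  \<comment> \<open>Dividing by \<open>Suc n\<close> places the positions at distinct values in
    [0,1), where \<open>frac\<close> is the identity.\<close>
  define x where "x = (\<lambda>i\<in>{1..n}. real (idx w i) / real (Suc n))"
  have x: "x \<in> real_space n"
    by (simp add: x_def real_space_def)
  have len: "length w = n"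
    using assms distinct_card[of w] by simp
  have coord: "coord (torus_proj n x) i = real (idx w i) / real (Suc n)" if "i \<in> {1..n}" for i
  proof -
    have "idx w i < n"
      using that assms(2) len idx_less_length[of w i] by simp
    then have frac: "frac (real (idx w i) / real (Suc n)) = real (idx w i) / real (Suc n)"
      by (simp add: frac_eq)
    have "x i = real (idx w i) / real (Suc n)"
      using that by (simp add: x_def)
    then show ?thesis
      using coord_torus_proj[OF x that] frac by simp
  qed
  have "sorted_wrt (\<lambda>i j. coord (torus_proj n x) i < coord (torus_proj n x) j) w"
  proof (unfold sorted_wrt_iff_nth_less, intro allI impI)
    fix k l assume kl: "k < l" "l < length w"
    have "w ! k \<in> {1..n}" "w ! l \<in> {1..n}"
      using kl assms(2) nth_mem[of _ w] by auto
    then show "coord (torus_proj n x) (w ! k) < coord (torus_proj n x) (w ! l)"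
      using kl assms(1) by (simp only: coord) (simp add: idx_nth divide_strict_right_mono)
  qed
  moreover have "inj_on (coord (torus_proj n x)) {1..n}"
  proof (rule inj_onI)
    fix a b assume ab: "a \<in> {1..n}" "b \<in> {1..n}" "coord (torus_proj n x) a = coord (torus_proj n x) b"
    then have "idx w a = idx w b"
      by (simp only: coord) simp
    then show "a = b"
      using ab(1,2) assms(2) by (metis nth_idx)
  qed
  moreover have "torus_proj n x \<in> torus n"
    using x by (simp add: torus_def torus_proj_def quotientI)
  ultimately show ?thesis by blast
qed

section \<open>Representatives of rotation classes\<close>

lemma rotation_class_self: "w \<in> rotation_class w"
  unfolding rotation_class_def by (auto intro: exI[of _ 0])

lemma rotation_class_memE:
  assumes "distinct w" "u \<in> rotation_class w"
  shows "distinct u" "set u = set w" "rotation_class u = rotation_class w"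
proof -
  obtain k where k: "u = rotate k w"
    using assms(2) by (auto simp: rotation_class_def)
  then show "distinct u" "set u = set w"
    using assms(1) by simp_all
  \<comment> \<open>Rotating by the complement of \<open>k\<close> modulo the length undoes the
    rotation by \<open>k\<close>.\<close>
  have "rotate m w = rotate (m + (length w - k mod length w)) u" for m
  proof (cases "w = []")
    case False
    then have "k mod length w \<le> length w"
      by (intro less_imp_le mod_less_divisor) simp
    then have "rotate (length w - k mod length w) (rotate (k mod length w) w) = w"
      by (simp add: rotate_rotate)
    then have "rotate (length w - k mod length w) u = w"
      unfolding k by (subst (asm) rotate_conv_mod[symmetric])
    then show ?thesis
      by (metis rotate_rotate)
  qed (simp add: k)
  moreover have "rotate m u = rotate (m + k) w" for m
    by (simp add: k rotate_rotate)
  ultimately show "rotation_class u = rotation_class w"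
    unfolding rotation_class_def by (auto; metis)
qed

lemma rotation_class_hd_unique:
  assumes "distinct w" "u \<in> rotation_class w" "hd u = hd w"
  shows "u = w"
  using assms rotate_eq_if_hd_eq by (auto simp: rotation_class_def)

text \<open>Forwards, a sample point sorted by \<open>w\<close> suffices. Backwards, a point of the
  order chamber is sorted by some rotation of \<open>w\<close>, whose orientation arises by flips;
  distinct coordinates keep the point off the arrangement.\<close>

lemma rotation_class_mem_extensions_iff:
  assumes P: "toric_poset n P" "Q \<in> P" and w: "distinct w" "set w = {1..n}"
  shows "rotation_class w \<in> toric_total_extensions n P \<longleftrightarrow> orient (underlying_graph P) w \<in> P"
proof
  note PD = toric_poset_memD[OF P]
  have edge: "a \<in> {1..n} \<and> b \<in> {1..n} \<and> a \<noteq> b" if "{a, b} \<in> underlying_graph P" for a b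
    using that PD underlying_graph_toric_class_iff[of a b n Q] by auto
  {
    assume "rotation_class w \<in> toric_total_extensions n P"
    then have sub: "order_chamber n (rotation_class w) \<subseteq> toric_chamber n P"
      by (simp add: toric_total_extensions_def)
    obtain p where p: "p \<in> torus n" "inj_on (coord p) {1..n}"
        "sorted_wrt (\<lambda>i j. coord p i < coord p j) w"
      using exists_torus_point_sorted[OF w] by blast
    then have "p \<in> toric_chamber n P"
      using sub rotation_class_self[of w] by (auto simp: order_chamber_def)
    then have "torus_orientation (underlying_graph P) p \<in> P"
      by (simp add: toric_chamber_def)
    then show "orient (underlying_graph P) w \<in> P"
      using torus_orientation_sorted[OF p(3), of "underlying_graph P"] edge w by simp
  }
  assume *: "orient (underlying_graph P) w \<in> P"
  have "order_chamber n (rotation_class w) \<subseteq> toric_chamber n P"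
  proof
    fix p assume "p \<in> order_chamber n (rotation_class w)"
    then obtain k where p: "p \<in> torus n" "inj_on (coord p) {1..n}"
        "sorted_wrt (\<lambda>i j. coord p i < coord p j) (rotate k w)"
      by (auto simp: order_chamber_def rotation_class_def)
    have "orient (underlying_graph P) (rotate k w) \<in> P"
      using orient_rotate_mem[OF w, of "underlying_graph P" Q k] edge * PD(1) by simp
    then have "torus_orientation (underlying_graph P) p \<in> P"
      using torus_orientation_sorted[OF p(3), of "underlying_graph P"] edge w by simp
    moreover have "p \<notin> toric_arrangement n (underlying_graph P)"
    proof
      assume "p \<in> toric_arrangement n (underlying_graph P)"
      then obtain x i j where x: "x \<in> real_space n" "p = torus_proj n x"
          "{i, j} \<in> underlying_graph P" "x i = x j"
        by (auto simp: toric_arrangement_def)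
      then have "coord p i = coord p j"
        using edge[OF x(3)] by (simp add: coord_torus_proj)
      then show False
        using p(2) edge[OF x(3)] by (auto dest: inj_onD)
    qed
    ultimately show "p \<in> toric_chamber n P"
      using p(1) by (simp add: toric_chamber_def)
  qed
  moreover have "w \<in> permutations_of_set {1..n}"
    using w by (auto simp: permutations_of_set_def)
  ultimately show "rotation_class w \<in> toric_total_extensions n P"
    by (auto simp: toric_total_extensions_def toric_total_orders_def)
qed

text \<open>A source on the path is its first vertex and a sink its last. The flip moves it to the
  other end: the reversed closing arc becomes a step of the path, and the reversed step becomes the
  closing arc.\<close>

lemma toric_path_flip:
  assumes path: "toric_path n Q zs" and len: "length zs \<ge> 2"
    and k: "is_source Q k \<or> is_sink Q k"
  shows "\<exists>r. toric_path n (flip k Q) (rotate r zs)"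
proof -
  have zs: "distinct zs" "set zs \<subseteq> {1..n}" "successively (\<lambda>i j. (i, j) \<in> Q) zs"
      "(hd zs, last zs) \<in> Q"
    using path len by (auto simp: toric_path_def)
  have unchanged: "successively (\<lambda>i j. (i, j) \<in> flip k Q) us"
    if "successively (\<lambda>i j. (i, j) \<in> Q) us" "k \<notin> set us" for us
    using that by (induction us rule: induct_list012) (auto simp: flip_def)
  show ?thesis
  proof (cases "k \<in> set zs")
    case False
    then have "hd zs \<noteq> k" "last zs \<noteq> k"
      using len hd_in_set[of zs] last_in_set[of zs] by fastforce+
    then have "toric_path n (flip k Q) (rotate 0 zs)"
      using path unchanged[OF zs(3) False] zs(4) by (auto simp: toric_path_def flip_def)
    then show ?thesis by blast
  next
    case True
    then obtain us vs where uv: "zs = us @ k # vs"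
      by (meson split_list)
    from k show ?thesis
    proof
      assume source: "is_source Q k"
      have "us = []"
      proof (rule ccontr)
        assume "us \<noteq> []"
        then have "(last us, k) \<in> Q"
          using zs(3) by (simp add: uv successively_append_iff)
        then show False using source by (simp add: is_source_def)
      qed
      then have z: "zs = k # vs" "vs \<noteq> []"
        using uv len by auto
      then have vs: "successively (\<lambda>i j. (i, j) \<in> Q) vs" "(k, hd vs) \<in> Q" "(k, last vs) \<in> Q"
        using zs(3,4) by (auto simp: successively_Cons)
      have "toric_path n (flip k Q) (rotate 1 zs)"
        using zs(1,2) z vs unchanged[OF vs(1)]
        by (auto simp: toric_path_def successively_append_iff flip_def)
      then show ?thesis by blast
    next
      assume sink: "is_sink Q k"
      have "vs = []"
      proof (rule ccontr)
        assume "vs \<noteq> []"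
        then have "(k, hd vs) \<in> Q"
          using zs(3) by (simp add: uv successively_append_iff successively_Cons)
        then show False using sink by (simp add: is_sink_def)
      qed
      then have z: "zs = us @ [k]" "us \<noteq> []"
        using uv len by auto
      then have us: "successively (\<lambda>i j. (i, j) \<in> Q) us" "(last us, k) \<in> Q" "(hd us, k) \<in> Q"
        using zs(3,4) by (auto simp: successively_append_iff)
      have "toric_path n (flip k Q) (k # us)"
        using zs(1,2) z us unchanged[OF us(1)]
        by (auto simp: toric_path_def successively_Cons flip_def)
      then have "toric_path n (flip k Q) (rotate (length us) zs)"
        by (simp add: z rotate_append)
      then show ?thesis by blast
    qed
  qed
qed

lemma toric_path_toric_class:
  assumes "toric_path n Q zs" "length zs \<ge> 2" "Q' \<in> toric_class n Q"
  shows "\<exists>r. toric_path n Q' (rotate r zs)"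
proof -
  have "(flip_step n)\<^sup>*\<^sup>* Q Q'"
    using assms(3) by (simp add: toric_class_def)
  then show ?thesis
  proof (induction rule: rtranclp_induct)
    case base
    show ?case using assms(1) by (auto intro: exI[of _ 0])
  next
    case (step Q1 Q2)
    then obtain r k where "toric_path n Q1 (rotate r zs)" "is_source Q1 k \<or> is_sink Q1 k"
        "Q2 = flip k Q1"
      by (auto simp: flip_step_def)
    then obtain s where "toric_path n Q2 (rotate s (rotate r zs))"
      using toric_path_flip[of n Q1 "rotate r zs" k] assms(2) by auto
    then show ?case by (auto simp: rotate_rotate)
  qed
qed

text \<open>Positions 0 and 1 leave no room for a letter before \<open>i\<close> or between
  \<open>i\<close> and \<open>j\<close>.\<close>

lemma sorted_idx_Cons_Cons:
  assumes "sorted_wrt (\<lambda>a b. idx (i # j # v) a < idx (i # j # v) b) u"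
    and "i \<in> set u" "j \<in> set u" "i \<noteq> j"
  obtains u' where "u = i # j # u'"
proof -
  obtain x u1 where u: "u = x # u1" using assms(2) by (cases u) auto
  have "x = i" using assms(1,2) u by auto
  then obtain y u2 where u1: "u1 = y # u2" using assms(3,4) u by (cases u1) auto
  have "y = j"
  proof (rule ccontr)
    assume "y \<noteq> j"
    then have "j \<in> set u2" using assms(3,4) u u1 \<open>x = i\<close> by auto
    then have "idx (i # j # v) i < idx (i # j # v) y" "idx (i # j # v) y < idx (i # j # v) j"
      using assms(1) u u1 \<open>x = i\<close> by auto
    then show False using assms(4) by simp
  qed
  then show ?thesis using that u u1 \<open>x = i\<close> by blast
qed

text \<open>Up to rotation a toric path persists in every member of the class, hence it occurs in this
  cyclic order in every toric total extension. A non-maximal path from \<open>a\<close> to \<open>b\<close> of length at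
  least two then puts a vertex strictly between \<open>a\<close> and \<open>b\<close> on both sides of the cycle.\<close>

lemma not_adjacent_if_removed:
  assumes Q: "(a, b) \<in> Q" "(a, b) \<notin> hasse_quiver n Q"
    and w: "orient G (i # j # v) \<in> toric_class n Q" "i \<noteq> j"
    and ab: "{a, b} = {i, j}"
  shows False
proof -
  let ?w = "i # j # v"
  obtain ys zs where ys: "toric_path n Q ys" "hd ys = a" "last ys = b" "length ys > 2"
    and zs: "toric_path n Q zs" "strict_sublist ys zs"
    using Q by (auto simp: hasse_quiver_def maximal_toric_path_def)
  obtain ps ss where split: "zs = ps @ ys @ ss" "ps @ ss \<noteq> []"
    using zs(2) unfolding strict_sublist_def sublist_def by force
  have "ys \<noteq> []" "tl ys \<noteq> []" "butlast (tl ys) \<noteq> []"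
    using ys(4) by (auto simp flip: length_greater_0_conv)
  then have ys_eq: "ys = a # butlast (tl ys) @ [b]"
    using ys(2,3) by (metis append_butlast_last_id last_tl list.collapse)
  define mid where "mid = butlast (tl ys)"
  have mid: "ys = a # mid @ [b]" "mid \<noteq> []"
    using ys_eq \<open>butlast (tl ys) \<noteq> []\<close> by (simp_all add: mid_def)
  obtain r where r: "toric_path n (orient G ?w) (rotate r zs)"
    using toric_path_toric_class[OF zs(1) _ w(1)] split mid by auto
  have "successively (\<lambda>x y. idx ?w x < idx ?w y) (rotate r zs)"
    by (rule successively_mono[of "\<lambda>x y. (x, y) \<in> orient G ?w"])
      (use r in \<open>auto simp: toric_path_def orient_def simp del: idx.simps\<close>)
  then have sorted: "sorted_wrt (\<lambda>x y. idx ?w x < idx ?w y) (rotate r zs)"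
    by (subst (asm) successively_iff_sorted_wrt_strong) (simp del: idx.simps)
  have "{i, j} \<subseteq> set (rotate r zs)"
    using split mid unfolding ab[symmetric] by auto
  \<comment> \<open>In the reading of the path that increases along the word, \<open>i\<close> and
    \<open>j\<close> must come first.\<close>
  then obtain u where u: "rotate r zs = i # j # u"
    using sorted_idx_Cons_Cons[OF sorted] w(2) by auto
  have dist: "distinct zs"
    using zs(1) by (simp add: toric_path_def)
  have "i # j # u \<in> rotation_class zs"
    unfolding u[symmetric] rotation_class_def by blast
  note dist_u = rotation_class_memE(1)[OF dist this] and class_u = rotation_class_memE(3)[OF dist this]
  have unique: "t = i # j # u" if "t = rotate m zs" "hd t = i" for t m
  proof (rule rotation_class_hd_unique[OF dist_u])
    show "t \<in> rotation_class (i # j # u)"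
      unfolding class_u that(1) by (auto simp: rotation_class_def)
  qed (simp add: that(2))
  \<comment> \<open>The cyclic readings of \<open>zs\<close> from \<open>a\<close> and from
    \<open>b\<close>. On one side \<open>mid\<close> separates them, nonempty by the length of
    \<open>ys\<close>; on the other \<open>ss @ ps\<close>, nonempty because the containment is
    strict.\<close>
  have rot_a: "a # mid @ b # ss @ ps = rotate (length ps) zs"
    by (simp add: split(1) mid rotate_append)
  have rot_b: "b # ss @ ps @ a # mid = rotate (length (ps @ a # mid)) zs"
    using rotate_append[of "ps @ a # mid" "b # ss"] by (simp add: split(1) mid)
  have dist': "distinct (a # mid @ b # ss @ ps)"
    unfolding rot_a using dist by simp
  from ab consider "a = i" "b = j" | "a = j" "b = i"
    by (auto simp: doubleton_eq_iff)
  then show False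
  proof cases
    case 1
    then have "mid @ b # ss @ ps = j # u"
      using unique[OF rot_a] by simp
    then show False using dist' mid(2) 1 by (cases mid) auto
  next
    case 2
    then have "(ss @ ps) @ a # mid = j # u"
      using unique[OF rot_b] by simp
    then show False using dist' split(2) 2 by (cases "ss @ ps") auto
  qed
qed

section \<open>Residues of toric total extensions\<close>

lemma toric_total_extension_memD:
  assumes "W \<in> toric_total_extensions n P" "w \<in> W"
  shows "distinct w" "set w = {1..n}" "W = rotation_class w"
proof -
  have "W \<in> rotation_class ` permutations_of_set {1..n}"
    using assms(1) unfolding toric_total_extensions_def toric_total_orders_def by blast
  then obtain w0 where w0: "w0 \<in> permutations_of_set {1..n}" "W = rotation_class w0"
    by blast
  note D = permutations_of_setD[OF w0(1)]
  note E = rotation_class_memE[OF D(2) assms(2)[unfolded w0(2)]]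
  show "distinct w" by (rule E(1))
  show "set w = {1..n}" by (rule E(2)[unfolded D(1)])
  show "W = rotation_class w" by (rule w0(2)[folded E(3)])
qed

lemma toric_total_extension_nonempty:
  assumes "W \<in> toric_total_extensions n P"
  obtains w where "w \<in> W"
  using assms rotation_class_self
  unfolding toric_total_extensions_def toric_total_orders_def by blast

lemma finite_toric_total_extensions: "finite (toric_total_extensions n P)"
  by (rule finite_subset[of _ "toric_total_orders n"])
    (auto simp: toric_total_extensions_def toric_total_orders_def)

text \<open>Since \<open>W\<close> is closed under rotation, a word beginning with \<open>i\<close>,
  \<open>j\<close> means that \<open>j\<close> follows \<open>i\<close> immediately on the
  cycle.\<close>

definition adjacent_extensions ::
    "nat \<Rightarrow> (nat \<times> nat) set set \<Rightarrow> nat \<Rightarrow> nat \<Rightarrow> nat list set set" where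
  "adjacent_extensions n P i j = {W \<in> toric_total_extensions n P. \<exists>v. i # j # v \<in> W}"

definition adjacent_tails :: "nat \<Rightarrow> (nat \<times> nat) set set \<Rightarrow> nat \<Rightarrow> nat \<Rightarrow> nat list set" where
  "adjacent_tails n P i j = {v. distinct (i # j # v) \<and> set (i # j # v) = {1..n} \<and>
     rotation_class (i # j # v) \<in> toric_total_extensions n P}"

lemma adjacent_tailsI:
  assumes "W \<in> toric_total_extensions n P" "i # j # v \<in> W"
  shows "v \<in> adjacent_tails n P i j" "W = rotation_class (i # j # v)"
proof -
  note D = toric_total_extension_memD[OF assms]
  show "W = rotation_class (i # j # v)"
    by (rule D(3))
  have "rotation_class (i # j # v) \<in> toric_total_extensions n P"
    using assms(1) unfolding D(3) .
  with D(1,2) show "v \<in> adjacent_tails n P i j"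
    unfolding adjacent_tails_def by blast
qed

lemma adjacent_tailsD:
  assumes "v \<in> adjacent_tails n P i j"
  shows "distinct (i # j # v)" "set (i # j # v) = {1..n}"
    "rotation_class (i # j # v) \<in> toric_total_extensions n P"
  using assms unfolding adjacent_tails_def by blast+

text \<open>A class has only one reading that starts with \<open>i\<close>. Sums over classes thus
  become sums over tails, where the swap of \<open>i\<close> and \<open>j\<close> fixes the
  tail.\<close>

lemma bij_betw_adjacent_tails:
  "bij_betw (\<lambda>v. rotation_class (i # j # v)) (adjacent_tails n P i j) (adjacent_extensions n P i j)"
proof (rule bij_betw_imageI)
  show "inj_on (\<lambda>v. rotation_class (i # j # v)) (adjacent_tails n P i j)"
  proof (rule inj_onI)
    fix v v' assume v': "v' \<in> adjacent_tails n P i j"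
      and eq: "rotation_class (i # j # v) = rotation_class (i # j # v')"
    have "i # j # v \<in> rotation_class (i # j # v')"
      using rotation_class_self unfolding eq[symmetric] .
    then have "i # j # v = i # j # v'"
      by (rule rotation_class_hd_unique[OF adjacent_tailsD(1)[OF v']]) simp
    then show "v = v'" by simp
  qed
  show "(\<lambda>v. rotation_class (i # j # v)) ` adjacent_tails n P i j = adjacent_extensions n P i j"
  proof (intro equalityI subsetI)
    fix W assume "W \<in> adjacent_extensions n P i j"
    then obtain v where "W \<in> toric_total_extensions n P" "i # j # v \<in> W"
      unfolding adjacent_extensions_def by blast
    from adjacent_tailsI[OF this]
    show "W \<in> (\<lambda>v. rotation_class (i # j # v)) ` adjacent_tails n P i j"
      by blast
  next
    fix W assume "W \<in> (\<lambda>v. rotation_class (i # j # v)) ` adjacent_tails n P i j"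
    then obtain v where v: "v \<in> adjacent_tails n P i j" "W = rotation_class (i # j # v)"
      by blast
    show "W \<in> adjacent_extensions n P i j"
      unfolding adjacent_extensions_def v(2)
      using adjacent_tailsD(3)[OF v(1)] rotation_class_self[of "i # j # v"] by blast
  qed
qed

lemma adjacent_tails_nonempty:
  assumes "n \<ge> 3" "v \<in> adjacent_tails n P i j"
  shows "v \<noteq> []"
proof
  assume "v = []"
  then have "{i, j} = {1..n}"
    using adjacent_tailsD(2)[OF assms(2)] by simp
  moreover have "card {i, j} \<le> 2"
    by (simp add: card_insert_if)
  ultimately have "card {1..n} \<le> 2"
    by simp
  then show False using assms(1) by simp
qed

text \<open>If each of \<open>i\<close>, \<open>j\<close> followed the other, the cycle would close
  after two letters.\<close>

lemma adjacent_extensions_disjoint: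
  assumes "n \<ge> 3"
  shows "adjacent_extensions n P i j \<inter> adjacent_extensions n P j i = {}"
proof (rule ccontr)
  assume "\<not> ?thesis"
  then obtain W v v' where W: "W \<in> toric_total_extensions n P" "i # j # v \<in> W" "j # i # v' \<in> W"
    by (auto simp: adjacent_extensions_def)
  note D = adjacent_tailsI[OF W(1,2)] and D' = adjacent_tailsI[OF W(1,3)]
  have v: "v \<noteq> []" by (rule adjacent_tails_nonempty[OF assms D(1)])
  have "rotate 1 (i # j # v) \<in> rotation_class (i # j # v)"
    unfolding rotation_class_def by blast
  then have "j # v @ [i] \<in> rotation_class (i # j # v)"
    by simp
  then have "j # v @ [i] \<in> rotation_class (j # i # v')"
    unfolding D(2)[symmetric] D'(2)[symmetric] .
  then have "j # v @ [i] = j # i # v'"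
    by (rule rotation_class_hd_unique[OF adjacent_tailsD(1)[OF D'(1)]]) simp
  then show False
    using v adjacent_tailsD(1)[OF D(1)] by (cases v) auto
qed

text \<open>Every cyclically consecutive pair heads some rotation, hence differs from
  \<open>{i, j}\<close>, and all factors of the denominator are units.\<close>

lemma regular_along_Psi_order_not_adjacent:
  assumes W: "W \<in> toric_total_extensions n P" and n: "n \<ge> 2"
    and "W \<notin> adjacent_extensions n P i j" "W \<notin> adjacent_extensions n P j i"
  shows "Psi_order W \<in> regular_along i j"
proof -
  obtain w where w: "w \<in> W" using toric_total_extension_nonempty[OF W] .
  note D = toric_total_extension_memD[OF W w]
  have len: "length w = n"
    using D distinct_card[of w] by simp
  then have ne: "w \<noteq> []" using n by auto
  have "(w @ [hd w]) ! k \<noteq> (w @ [hd w]) ! Suc k \<and>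
      {(w @ [hd w]) ! k, (w @ [hd w]) ! Suc k} \<noteq> {i, j}"
    if "Suc k < length (w @ [hd w])" for k
  proof -
    obtain x y v where xy: "rotate k w = x # y # v"
      using n len by (metis One_nat_def Suc_le_length_iff length_rotate numeral_2_eq_2)
    have "k < length w" using that by simp
    have "rotate k w ! 0 = w ! k" "rotate k w ! 1 = w ! (Suc k mod length w)"
      using \<open>k < length w\<close> n len by (simp_all add: nth_rotate)
    then have nth: "(w @ [hd w]) ! k = x" "(w @ [hd w]) ! Suc k = y"
      using \<open>k < length w\<close> ne xy
      by (cases "Suc k = length w"; simp add: nth_append hd_conv_nth)+
    have "x # y # v \<in> W"
      unfolding D(3) xy[symmetric] rotation_class_def by blast
    moreover from this have "x \<noteq> y"
      using toric_total_extension_memD(1)[OF W] by force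
    ultimately show ?thesis
      using W assms(3,4) unfolding nth adjacent_extensions_def by (auto simp: doubleton_eq_iff)
  qed
  then have "Psi_word w \<in> regular_along i j"
    by (intro regular_along_Psi_word) (auto simp: successively_conv_nth)
  then show ?thesis
    by (simp add: D(3) Psi_order_rotation_class)
qed

lemma Psi_tor_simple_pole:
  assumes "n \<ge> 3"
  shows "Psi_tor n P * (indet i - indet j) \<in> regular_along i j"
  unfolding Psi_tor_def sum_distrib_right
proof (rule regular_along_sum)
  fix W assume W: "W \<in> toric_total_extensions n P"
  have adj: "Psi_order W * (indet i - indet j) \<in> regular_along i j"
    if adjacent: "W \<in> adjacent_extensions n P i j" for i j
  proof -
    obtain v where "W \<in> toric_total_extensions n P" "i # j # v \<in> W"
      using adjacent unfolding adjacent_extensions_def by blast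
    note v = adjacent_tailsI[OF this]
    show ?thesis
      unfolding v(2) Psi_order_rotation_class
      by (intro regular_along_simple_pole adjacent_tailsD(1)[OF v(1)]
          adjacent_tails_nonempty[OF assms v(1)])
  qed
  show "Psi_order W * (indet i - indet j) \<in> regular_along i j"
  proof (cases "W \<in> adjacent_extensions n P i j \<or> W \<in> adjacent_extensions n P j i")
    case True
    \<comment> \<open>The case of \<open>i\<close> following \<open>j\<close> differs by a sign
      only.\<close>
    moreover have "Psi_order W * (indet i - indet j) = - (Psi_order W * (indet j - indet i))"
      by (simp add: algebra_simps)
    ultimately show ?thesis
      using adj[of i j] adj[of j i] regular_along_minus regular_along_commute[of i j] by metis
  next
    case False
    then show ?thesis
      using regular_along_Psi_order_not_adjacent[OF W] assms
      by (intro regular_along_mult) auto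
  qed
qed

lemma Psi_tor_regular_along:
  assumes P: "toric_poset n P" "Q \<in> P" and n: "n \<ge> 3" and ij: "i \<noteq> j"
    and removed: "(i, j) \<notin> hasse_quiver n Q" "(j, i) \<notin> hasse_quiver n Q"
  shows "(Psi_tor n P :: 'k::field mpoly fract) \<in> regular_along i j"
proof -
  note PD = toric_poset_memD[OF P]
  let ?E = "toric_total_extensions n P"
  let ?A = "adjacent_extensions n P i j" and ?B = "adjacent_extensions n P j i"
  have tails: "orient (underlying_graph P) (a # b # v) \<in> P"
    if "v \<in> adjacent_tails n P a b" for a b v
    using that rotation_class_mem_extensions_iff[OF P, of "a # b # v"]
    unfolding adjacent_tails_def by blast
  have "(\<Sum>W\<in>?A \<union> ?B. Psi_order W :: 'k mpoly fract) \<in> regular_along i j"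
  \<comment> \<open>Hasse arcs are arcs of \<open>Q\<close>, so the hypotheses leave a removed arc
    or a non-edge.\<close>
  proof (cases "(i, j) \<in> Q \<or> (j, i) \<in> Q")
    case True
    have not_adjacent: False
      if "(a, b) \<in> Q" "(a, b) \<notin> hasse_quiver n Q"
        "orient (underlying_graph P) (c # d # v) \<in> P" "c \<noteq> d" "{a, b} = {c, d}" for a b c d v
      using not_adjacent_if_removed[OF that(1,2) _ that(4,5)] that(3) PD(1) by simp
    have "{j, i} = {i, j}" by blast
    with True removed ij have no_word: "orient (underlying_graph P) (c # d # v) \<notin> P"
      if "c = i \<and> d = j \<or> c = j \<and> d = i" for c d v
      using not_adjacent[of i j c d v] not_adjacent[of j i c d v] that by fastforce
    have "adjacent_tails n P i j = {}" "adjacent_tails n P j i = {}"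
      using tails no_word by blast+
    then have "?A \<union> ?B = {}"
      using adjacent_tailsI(1) unfolding adjacent_extensions_def by blast
    then show ?thesis by simp
  next
    case False
    then have "{i, j} \<notin> underlying_graph P"
      unfolding PD(1) underlying_graph_toric_class_iff .
    then have "orient (underlying_graph P) (i # j # v) = orient (underlying_graph P) (j # i # v)" for v
      using ij by (rule orient_swap)
    then have "rotation_class (i # j # v) \<in> ?E \<longleftrightarrow> rotation_class (j # i # v) \<in> ?E"
      if "distinct (i # j # v)" "set (i # j # v) = {1..n}" for v
      using rotation_class_mem_extensions_iff[OF P that]
        rotation_class_mem_extensions_iff[OF P, of "j # i # v"] that by (simp add: insert_commute)
    moreover have "distinct (j # i # v) \<longleftrightarrow> distinct (i # j # v)" "set (j # i # v) = set (i # j # v)" for v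
      by auto
    \<comment> \<open>The pairing of extensions is the identity on tails.\<close>
    ultimately have tails_eq: "adjacent_tails n P j i = adjacent_tails n P i j"
      unfolding adjacent_tails_def by (intro Collect_cong) metis
    have fin: "finite ?A" "finite ?B"
      unfolding adjacent_extensions_def using finite_toric_total_extensions[of n P] by simp_all
    have reindex: "(\<Sum>W\<in>adjacent_extensions n P a b. Psi_order W) =
        (\<Sum>v\<in>adjacent_tails n P a b. Psi_word (a # b # v) :: 'k mpoly fract)" for a b
      using sum.reindex_bij_betw[OF bij_betw_adjacent_tails,
          of "Psi_order :: nat list set \<Rightarrow> 'k mpoly fract" a b n P]
      by (simp add: Psi_order_rotation_class)
    have "(\<Sum>W\<in>?A \<union> ?B. Psi_order W) = (\<Sum>v\<in>adjacent_tails n P i j.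
        Psi_word (i # j # v) + Psi_word (j # i # v) :: 'k mpoly fract)"
      using adjacent_extensions_disjoint[OF n] fin
      by (simp add: sum.union_disjoint reindex tails_eq sum.distrib)
    also have "\<dots> \<in> regular_along i j"
    proof (rule regular_along_sum)
      fix v assume v: "v \<in> adjacent_tails n P i j"
      from adjacent_tailsD(1)[OF v]
      show "(Psi_word (i # j # v) + Psi_word (j # i # v) :: 'k mpoly fract) \<in> regular_along i j"
        using adjacent_tails_nonempty[OF n v] by (rule regular_along_swap)
    qed
    finally show ?thesis .
  qed
  moreover have "(\<Sum>W\<in>?E - (?A \<union> ?B). Psi_order W :: 'k mpoly fract) \<in> regular_along i j"
    using n by (intro regular_along_sum regular_along_Psi_order_not_adjacent[of _ n P]) auto
  moreover have "?A \<union> ?B \<subseteq> ?E"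
    by (auto simp: adjacent_extensions_def)
  ultimately show ?thesis
    unfolding Psi_tor_def
    by (subst sum.subset_diff[OF \<open>?A \<union> ?B \<subseteq> ?E\<close> finite_toric_total_extensions])
      (rule regular_along_add)
qed

theorem theorem1p6:
  fixes n :: nat and P :: "(nat \<times> nat) set set" and Q :: "(nat \<times> nat) set"
  assumes "n \<noteq> 2"
    and "toric_poset n P"
    and "Q \<in> P"
  shows "\<exists>p :: 'k::field mpoly. poly_vars p \<subseteq> {1..n} \<and>
    Psi_tor n P = poly_fract p / edge_product (underlying_graph (toric_hasse n Q))"
proof -
  let ?H = "hasse_quiver n Q" and ?V = "{1..n}"
  \<comment> \<open>One ordered pair per Hasse edge, matching the sign convention of
    \<open>edge_product\<close>.\<close>
  define S where "S = {(i, j). i < j \<and> ((i, j) \<in> ?H \<or> (j, i) \<in> ?H)}"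
  define D :: "'k mpoly fract" where "D = edge_product (underlying_graph (toric_hasse n Q))"
  have D: "D = (\<Prod>(i, j)\<in>S. indet i - indet j)"
    by (simp add: D_def edge_product_def toric_hasse_def underlying_graph_toric_class_iff S_def)
  have "?H \<subseteq> ?V \<times> ?V"
    using toric_poset_memD(2)[OF assms(2,3)] by (auto simp: hasse_quiver_def)
  then have S: "S \<subseteq> ?V \<times> ?V"
    by (auto simp: S_def)
  then have "finite S"
    by (rule finite_subset) simp
  have "D \<noteq> 0"
    using \<open>finite S\<close> by (auto simp: D S_def)
  have "Psi_tor n P * D \<in> braid_functions ?V"
  proof (intro braid_functions_mult)
    show "Psi_tor n P \<in> braid_functions ?V"
      unfolding Psi_tor_def
    proof (rule braid_functions_sum)
      fix W assume W: "W \<in> toric_total_extensions n P"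
      then obtain w where "w \<in> W" using toric_total_extension_nonempty by blast
      from toric_total_extension_memD[OF W this] show "Psi_order W \<in> braid_functions ?V"
        by (simp add: Psi_order_rotation_class braid_functions_Psi_word)
    qed
    show "D \<in> braid_functions ?V"
      unfolding D using S by (intro braid_functions_prod) (auto intro: braid_functions_indet_diff)
  qed
  moreover have "Psi_tor n P * D \<in> regular_along i j" if ij: "i \<in> ?V" "j \<in> ?V" "i < j" for i j
  proof -
    \<comment> \<open>Two distinct vertices already force n to be at least 2; for smaller n there is
      no hyperplane to examine.\<close>
    have n: "n \<ge> 3" using ij assms(1) by auto
    show ?thesis
    proof (cases "(i, j) \<in> S")
      case True
      \<comment> \<open>The factor of the edge is split off to absorb the simple pole of
        \<open>Psi_tor n P\<close>.\<close>
      have "D = (indet i - indet j) * (\<Prod>(i, j)\<in>S - {(i, j)}. indet i - indet j)"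
        unfolding D by (subst prod.remove[OF \<open>finite S\<close> True]) simp
      moreover have "(\<Prod>(i, j)\<in>S - {(i, j)}. indet i - indet j) \<in> regular_along i j"
        by (rule regular_along_prod) auto
      ultimately show ?thesis
        using regular_along_mult[OF Psi_tor_simple_pole[OF n]] by (simp add: mult.assoc)
    next
      case False
      have "D \<in> regular_along i j"
        unfolding D by (rule regular_along_prod) auto
      then show ?thesis
        using Psi_tor_regular_along[OF assms(2,3) n, of i j] False ij(3)
        by (intro regular_along_mult) (auto simp: S_def)
    qed
  qed
  then have "Psi_tor n P * D \<in> regular_along i j" if "i \<in> ?V" "j \<in> ?V" "i \<noteq> j" for i j
    using that regular_along_commute by (metis linorder_neqE_nat)
  ultimately obtain p where "poly_vars p \<subseteq> ?V" "Psi_tor n P * D = poly_fract p"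
    using braid_function_regular_imp_poly by blast
  then show ?thesis
    using \<open>D \<noteq> 0\<close> unfolding D_def by (metis nonzero_eq_divide_eq)
qed

end
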